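(* For any positive integer $n$, there exists a finite $2$-generated group $G$ such that (1) $e(G)\geq n$; and (2) $e(G,g)\leq 5$ for some $g\in G$.
   Context: For a nontrivial finite group $G$ and a subset $Y\subseteq G$, let $(x_n)_{n\geq 1}$ be a sequence of independent, uniformly distributed $G$-valued random variables, and let $\tau_{G,Y}=\min\{n\geq 1\mid \langle Y,x_1,\dots,x_n\rangle=G\}\in[0,+\infty]$. Define $e(G,Y)$ to be the expectation of $\tau_{G,Y}$. Write $e(G)=e(G,\emptyset)$ and $e(G,g)=e(G,\{g\})$ for $g\in G$. A group is $2$-generated if it can be generated by two elements. *)

theory Defs
  imports "HOL-Probability.Probability" "HOL-Algebra.Generated_Groups"
begin

text \<open>The law of a sequence \<open>x\<^sub>1, x\<^sub>2, \<dots>\<close> of independent, uniformly distributed elements of a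
  finite group: the product of uniform measures, indexed by the positive naturals.\<close>

definition unif_seq :: "('a, 'b) monoid_scheme \<Rightarrow> (nat \<Rightarrow> 'a) measure" where
  "unif_seq G = (\<Pi>\<^sub>M i\<in>{1..}. uniform_count_measure (carrier G))"

text \<open>The infimum in \<^typ>\<open>enat\<close> is the minimum if the set is nonempty, and \<open>\<infinity>\<close> otherwise. As \<open>n\<close>
  ranges over the positive integers, the value is at least 1 even if \<open>Y\<close> generates \<open>G\<close>.\<close>

definition gen_time :: "('a, 'b) monoid_scheme \<Rightarrow> 'a set \<Rightarrow> (nat \<Rightarrow> 'a) \<Rightarrow> enat" where
  "gen_time G Y x = (INF n\<in>{n. 1 \<le> n \<and> generate G (Y \<union> x ` {1..n}) = carrier G}. enat n)"

definition exp_gen_time :: "('a, 'b) monoid_scheme \<Rightarrow> 'a set \<Rightarrow> ennreal" where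
  "exp_gen_time G Y = (\<integral>\<^sup>+ x. ennreal_of_enat (gen_time G Y x) \<partial>unif_seq G)"

definition two_generated :: "('a, 'b) monoid_scheme \<Rightarrow> bool" where
  "two_generated G \<longleftrightarrow> (\<exists>a\<in>carrier G. \<exists>b\<in>carrier G. generate G {a, b} = carrier G)"

text \<open>The coordinates under \<^const>\<open>unif_seq\<close> are independent and uniform, and the generation time
  is measurable, so that the integral above is a genuine expectation.\<close>

lemma prob_space_unif_seq:
  assumes "finite (carrier G)" "carrier G \<noteq> {}"
  shows "prob_space (unif_seq G)"
  unfolding unif_seq_def
  by (intro prob_space_PiM prob_space_uniform_count_measure assms)

lemma distr_unif_seq:
  assumes "finite (carrier G)" "carrier G \<noteq> {}" "1 \<le> i"
  shows "distr (unif_seq G) (uniform_count_measure (carrier G)) (\<lambda>x. x i)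
    = uniform_count_measure (carrier G)"
  unfolding unif_seq_def
  using assms by (intro distr_PiM_component prob_space_uniform_count_measure) auto

lemma indep_vars_unif_seq:
  assumes "finite (carrier G)" "carrier G \<noteq> {}"
  shows "prob_space.indep_vars (unif_seq G) (\<lambda>_. uniform_count_measure (carrier G)) (\<lambda>i x. x i) {1..}"
proof -
  interpret prob_space "unif_seq G" by (rule prob_space_unif_seq[OF assms])
  have meas: "random_variable (uniform_count_measure (carrier G)) (\<lambda>x. x i)" if "i \<in> {1..}" for i
    using that unfolding unif_seq_def by (rule measurable_component_singleton)
  have "distr (unif_seq G) (\<Pi>\<^sub>M i\<in>{1..}. uniform_count_measure (carrier G))
          (\<lambda>x. \<lambda>i\<in>{1..}. x i) = distr (unif_seq G) (unif_seq G) (\<lambda>x. x)"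
    unfolding unif_seq_def
    by (intro distr_cong) (auto simp: space_PiM PiE_def extensional_restrict)
  also have "\<dots> = (\<Pi>\<^sub>M i\<in>{1..}. uniform_count_measure (carrier G))"
    by (simp add: unif_seq_def)
  also have "\<dots> = (\<Pi>\<^sub>M i\<in>{1..}. distr (unif_seq G) (uniform_count_measure (carrier G)) (\<lambda>x. x i))"
    by (intro PiM_cong refl) (simp add: distr_unif_seq[OF assms])
  finally show ?thesis
    by (subst indep_vars_iff_distr_eq_PiM') (use meas in auto)
qed

lemma measurable_gen_time:
  assumes "finite (carrier G)"
  shows "gen_time G Y \<in> measurable (unif_seq G) (count_space UNIV)"
proof -
  let ?U = "uniform_count_measure (carrier G)"
  have *: "Measurable.pred (unif_seq G) (\<lambda>x. generate G (Y \<union> x ` {1..n}) = carrier G)" for n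
  proof -
    have r: "(\<lambda>x. restrict x {1..n}) \<in> measurable (unif_seq G) (\<Pi>\<^sub>M i\<in>{1..n}. ?U)"
      unfolding unif_seq_def by (rule measurable_restrict_subset) auto
    have "sets (\<Pi>\<^sub>M i\<in>{1..n}. ?U) = sets (\<Pi>\<^sub>M i\<in>{1..n}. count_space (carrier G))"
      by (intro sets_PiM_cong refl) (simp add: sets_uniform_count_measure)
    also have "\<dots> = sets (count_space (Pi\<^sub>E {1..n} (\<lambda>_. carrier G)))"
      using assms by (subst count_space_PiM_finite) (auto intro: countable_finite)
    finally have eq: "sets (\<Pi>\<^sub>M i\<in>{1..n}. ?U) = sets (count_space (Pi\<^sub>E {1..n} (\<lambda>_. carrier G)))" .
    have "Measurable.pred (count_space (Pi\<^sub>E {1..n} (\<lambda>_. carrier G)))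
            (\<lambda>y. generate G (Y \<union> y ` {1..n}) = carrier G)"
      by simp
    then have "Measurable.pred (\<Pi>\<^sub>M i\<in>{1..n}. ?U) (\<lambda>y. generate G (Y \<union> y ` {1..n}) = carrier G)"
      using measurable_cong_sets[OF eq refl] by blast
    from measurable_compose[OF r this] show ?thesis
      by simp
  qed
  have "(\<lambda>x. INF n. if 1 \<le> n \<and> generate G (Y \<union> x ` {1..n}) = carrier G then enat n else \<infinity>)
          \<in> measurable (unif_seq G) (count_space UNIV)"
    using * by (intro measurable_INF) (auto intro!: measurable_If)
  moreover have "gen_time G Y = (\<lambda>x. INF n. if 1 \<le> n \<and> generate G (Y \<union> x ` {1..n}) = carrier G
      then enat n else \<infinity>)"
  proof
    fix x
    show "gen_time G Y x = (INF n. if 1 \<le> n \<and> generate G (Y \<union> x ` {1..n}) = carrier G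
      then enat n else \<infinity>)"
      unfolding gen_time_def
    proof (intro antisym INF_greatest)
      fix m
      show "(INF n\<in>{n. 1 \<le> n \<and> generate G (Y \<union> x ` {1..n}) = carrier G}. enat n)
        \<le> (if 1 \<le> m \<and> generate G (Y \<union> x ` {1..m}) = carrier G then enat m else \<infinity>)"
        by (auto intro: INF_lower)
    next
      fix m assume "m \<in> {n. 1 \<le> n \<and> generate G (Y \<union> x ` {1..n}) = carrier G}"
      then show "(INF n. if 1 \<le> n \<and> generate G (Y \<union> x ` {1..n}) = carrier G then enat n else \<infinity>)
        \<le> enat m"
        by (intro INF_lower2[of m]) auto
    qed
  qed
  ultimately show ?thesis
    by (simp only:)
qed

end

theory Submission
  imports Defs "HOL-Algebra.Sym_Groups" "HOL-Algebra.Product_Groups"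
begin

text \<open>
  The group is a power \<open>A\<^sub>m\<^sup>k\<close> of an alternating group, with \<open>k = m\<^sup>2\<^sup>n\<close> and \<open>m\<close> huge compared to \<open>n\<close>. For
  \<open>2n\<close> random elements the probability that all of them fix the point 1 in a given coordinate is at
  least \<open>m\<^sup>-\<^sup>2\<^sup>n = 1/k\<close>, so with probability at least \<open>1 - 1/e\<close> this happens in some coordinate, which
  prevents generation; hence \<open>e(G) \<ge> n\<close>.

  The helpful element \<open>g\<close> is constant, equal in every coordinate to the product of a cycle \<open>h\<close> on a set
  \<open>A\<close> of bounded odd size \<open>Q\<close> and a cycle \<open>w\<close> on the complement \<open>Z\<close>, of size \<open>M\<close> with \<open>M mod Q = 1\<close>, so
  that powers of \<open>g\<close> yield both \<open>h\<close> and \<open>w\<close>. If \<open>y\<close> lies in the subgroup generated by \<open>g\<close> and \<open>x\<close>, and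
  \<open>y\<^sub>i(A)\<close> meets \<open>A\<close> in exactly one point while \<open>y\<^sub>j(A)\<close> misses \<open>A\<close>, then the commutator of \<open>h\<close> and
  \<open>y h y\<^sup>-\<^sup>1\<close> is a 3-cycle in coordinate \<open>i\<close> and trivial in coordinate \<open>j\<close>. Conjugation by \<open>h\<close> and \<open>w\<close>
  turns this 3-cycle into all 3-cycles, and since \<open>A\<^sub>m\<close> is perfect, having this for all pairs
  \<open>i \<noteq> j\<close> suffices for generation.

  Such a \<open>y\<close> is sought among the words \<open>x h\<^sup>s w\<^sup>u x\<close>, where the condition concerns how shifts of \<open>x(A)\<close>
  meet \<open>x\<^sup>-\<^sup>1(A)\<close>. If no shift works, then almost every point of \<open>x\<^sup>-\<^sup>1(A)\<close> has another one in a set of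
  boundedly many candidates, so at most half of the \<open>Q\<close> points determine the others up to boundedly
  many choices. For fixed \<open>Q\<close> large this has probability \<open>O(m\<^sup>-\<^sup>4\<^sup>n\<^sup>-\<^sup>1)\<close>, which survives the union bound over
  the \<open>k\<^sup>2\<close> pairs. Thus \<open>g\<close> and a single random element generate with probability at least \<open>1/2\<close>, which
  gives 2-generation and \<open>e(G, g) \<le> 2\<close>.
\<close>

section \<open>Expected generation times from counting\<close>

text \<open>A run of \<open>t\<close> draws without generation forces each single draw to be bad, so
  by independence the tail probability is at most \<open>(1/2)^t\<close>. The tails sum to a
  geometric series with value 2.\<close>

lemma exp_gen_time_le_2:
  assumes "group G" and fin: "finite (carrier G)" and Y: "Y \<subseteq> carrier G"
    and bad: "2 * card {x \<in> carrier G. generate G (insert x Y) \<noteq> carrier G} \<le> card (carrier G)"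
  shows "exp_gen_time G Y \<le> 2"
proof -
  interpret group G by fact
  let ?U = "uniform_count_measure (carrier G)"
  define Bad where "Bad = {x \<in> carrier G. generate G (insert x Y) \<noteq> carrier G}"
  have ne: "carrier G \<noteq> {}" by auto
  interpret U: prob_space ?U by (rule prob_space_uniform_count_measure[OF fin ne])
  interpret product_prob_space "\<lambda>_::nat. ?U" "{1..}" by unfold_locales
  have cpos: "card (carrier G) > 0" using fin ne by (simp add: card_gt_0_iff)
  have emBad: "emeasure ?U Bad \<le> ennreal (1/2)"
  proof -
    have "emeasure ?U Bad = ennreal (real (card Bad) / real (card (carrier G)))"
      using fin by (subst emeasure_uniform_count_measure) (auto simp: Bad_def)
    also have "\<dots> \<le> ennreal (1/2)"
    proof (rule ennreal_leI)
      have "2 * real (card Bad) \<le> real (card (carrier G))"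
        using bad unfolding Bad_def by linarith
      then show "real (card Bad) / real (card (carrier G)) \<le> 1/2"
        using cpos by (simp add: divide_simps)
    qed
    finally show ?thesis .
  qed
  have tail: "emeasure (unif_seq G) {x \<in> space (unif_seq G). enat t < gen_time G Y x} \<le> ennreal ((1/2)^t)" for t
  proof -
    have sub: "{x \<in> space (unif_seq G). enat t < gen_time G Y x}
        \<subseteq> prod_emb {1..} (\<lambda>_. ?U) {1..t} (Pi\<^sub>E {1..t} (\<lambda>_. Bad))"
    proof
      fix x assume x: "x \<in> {x \<in> space (unif_seq G). enat t < gen_time G Y x}"
      then have xc: "x \<in> Pi\<^sub>E {1..} (\<lambda>_. carrier G)"
        by (simp add: unif_seq_def space_PiM space_uniform_count_measure)
      have "x i \<in> Bad" if i: "i \<in> {1..t}" for i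
      proof (rule ccontr)
        have xi: "x i \<in> carrier G" using xc i by (auto simp: PiE_iff)
        assume "x i \<notin> Bad"
        then have g: "generate G (insert (x i) Y) = carrier G" using xi by (simp add: Bad_def)
        have sub: "Y \<union> x ` {1..i} \<subseteq> carrier G" using xc Y by (auto simp: PiE_iff)
        have "generate G (insert (x i) Y) \<subseteq> generate G (Y \<union> x ` {1..i})"
          by (rule mono_generate) (use i in auto)
        with g generate_incl[OF sub] have "generate G (Y \<union> x ` {1..i}) = carrier G" by auto
        then have "gen_time G Y x \<le> enat i" unfolding gen_time_def
          using i by (intro INF_lower) auto
        also have "\<dots> \<le> enat t" using i by simp
        finally show False using x by auto
      qed
      then show "x \<in> prod_emb {1..} (\<lambda>_. ?U) {1..t} (Pi\<^sub>E {1..t} (\<lambda>_. Bad))"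
        using xc by (auto simp: prod_emb_def space_uniform_count_measure PiE_iff)
    qed
    have "emeasure (unif_seq G) {x \<in> space (unif_seq G). enat t < gen_time G Y x}
        \<le> emeasure (unif_seq G) (prod_emb {1..} (\<lambda>_. ?U) {1..t} (Pi\<^sub>E {1..t} (\<lambda>_. Bad)))"
      by (rule emeasure_mono[OF sub])
        (auto simp: unif_seq_def sets_uniform_count_measure Bad_def intro!: sets_PiM_I)
    also have "\<dots> = (\<Prod>i\<in>{1..t}. emeasure ?U Bad)"
      unfolding unif_seq_def
      by (rule emeasure_PiM_emb) (auto simp: sets_uniform_count_measure Bad_def)
    also have "\<dots> \<le> ennreal (1/2) ^ t"
      using emBad by (simp add: power_mono)
    also have "\<dots> = ennreal ((1/2)^t)" by (rule ennreal_power) simp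
    finally show ?thesis .
  qed
  have "exp_gen_time G Y = (\<Sum>t. emeasure (unif_seq G) {x \<in> space (unif_seq G). enat t < gen_time G Y x})"
    unfolding exp_gen_time_def by (rule nn_integral_enat_function[OF measurable_gen_time[OF fin]])
  also have "\<dots> \<le> (\<Sum>t. ennreal ((1/2)^t))"
    by (intro suminf_le tail) auto
  also have "\<dots> = ennreal 2"
    using geometric_sums[of "1/2::real"] by (intro suminf_ennreal_eq) auto
  finally show ?thesis by simp
qed

text \<open>With probability at least 1/2 the first \<open>2*n\<close> draws fail to generate. On
  that event the generation time is at least \<open>2*n\<close>, which already contributes
  \<open>n\<close> to the expectation.\<close>

lemma exp_gen_time_ge:
  assumes "group G" and fin: "finite (carrier G)"
    and few: "2 * card {f \<in> {1..2*n} \<rightarrow>\<^sub>E carrier G. generate G (f ` {1..2*n}) = carrier G}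
      \<le> card (carrier G) ^ (2*n)"
  shows "exp_gen_time G {} \<ge> of_nat n"
proof -
  interpret group G by fact
  let ?U = "uniform_count_measure (carrier G)" and ?D = "2*n"
  define E where "E = {f \<in> {1..?D} \<rightarrow>\<^sub>E carrier G. generate G (f ` {1..?D}) = carrier G}"
  define c where "c = card (carrier G)"
  have ne: "carrier G \<noteq> {}" by auto
  interpret U: prob_space ?U by (rule prob_space_uniform_count_measure[OF fin ne])
  interpret product_prob_space "\<lambda>_::nat. ?U" "{1..}" by unfold_locales
  have cpos: "c > 0" using fin ne by (simp add: card_gt_0_iff c_def)
  have finE: "finite E" unfolding E_def
    by (rule finite_subset[of _ "{1..?D} \<rightarrow>\<^sub>E carrier G"]) (use fin in \<open>auto intro: finite_PiE\<close>)
  \<comment> \<open>The cylinder of sequences whose first \<open>2*n\<close> entries are given by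
    \<open>f\<close>; generation by time \<open>2*n\<close> is covered by the finitely many
    cylinders over \<open>E\<close>.\<close>
  define F where "F = (\<lambda>f. prod_emb {1..} (\<lambda>_::nat. ?U) {1..?D} (Pi\<^sub>E {1..?D} (\<lambda>i. {f i})))"
  have Fs: "F f \<in> sets (unif_seq G)" if "f \<in> E" for f
    using that unfolding F_def unif_seq_def E_def
    by (intro sets_PiM_I) (auto simp: sets_uniform_count_measure PiE_iff)
  have emF: "emeasure (unif_seq G) (F f) = ennreal ((1 / c) ^ ?D)" if f: "f \<in> E" for f
  proof -
    have fi: "f i \<in> carrier G" if "i \<in> {1..?D}" for i
      using f that by (auto simp: E_def PiE_iff)
    have "emeasure (unif_seq G) (F f) = (\<Prod>i\<in>{1..?D}. emeasure ?U {f i})"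
      unfolding F_def unif_seq_def
      by (rule emeasure_PiM_emb) (use fi in \<open>auto simp: sets_uniform_count_measure\<close>)
    also have "\<dots> = (\<Prod>i\<in>{1..?D}. ennreal (1 / c))"
      by (intro prod.cong refl, subst emeasure_uniform_count_measure) (use fi fin in \<open>auto simp: c_def\<close>)
    also have "\<dots> = ennreal ((1 / c) ^ ?D)"
      by (simp add: ennreal_power del: power_mult)
    finally show ?thesis .
  qed
  let ?B = "\<Union>f\<in>E. F f"
  have Bs: "?B \<in> sets (unif_seq G)" using finE Fs by auto
  have "emeasure (unif_seq G) ?B \<le> (\<Sum>f\<in>E. emeasure (unif_seq G) (F f))"
    by (rule emeasure_subadditive_finite) (use finE Fs in auto)
  also have "\<dots> = (\<Sum>f\<in>E. ennreal ((1 / c) ^ ?D))" using emF by simp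
  also have "\<dots> = ennreal (card E * (1 / c) ^ ?D)"
    by (subst sum_ennreal) auto
  also have "\<dots> \<le> ennreal (1/2)"
  proof (rule ennreal_leI)
    have "2 * real (card E) \<le> real c ^ ?D" using few unfolding E_def c_def
      by (metis (no_types, lifting) of_nat_le_iff of_nat_mult of_nat_numeral of_nat_power)
    then show "card E * (1 / c) ^ ?D \<le> 1/2"
      using cpos by (simp add: power_one_over divide_simps del: power_mult)
  qed
  finally have emB: "emeasure (unif_seq G) ?B \<le> ennreal (1/2)" .
  interpret X: prob_space "unif_seq G" by (rule prob_space_unif_seq[OF fin ne])
  have half: "emeasure (unif_seq G) (space (unif_seq G) - ?B) \<ge> ennreal (1/2)"
  proof -
    have "X.prob ?B \<le> 1/2" using emB unfolding X.emeasure_eq_measure by (subst (asm) ennreal_le_iff) auto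
    then have "X.prob (space (unif_seq G) - ?B) \<ge> 1/2"
      using X.prob_compl[OF Bs] by simp
    then show ?thesis unfolding X.emeasure_eq_measure by (rule ennreal_leI)
  qed
  have lower: "of_nat ?D * indicator (space (unif_seq G) - ?B) x \<le> ennreal_of_enat (gen_time G {} x)"
    if x: "x \<in> space (unif_seq G)" for x
  proof (cases "x \<in> ?B")
    case False
    have xc: "x \<in> Pi\<^sub>E {1..} (\<lambda>_. carrier G)"
      using x by (simp add: unif_seq_def space_PiM space_uniform_count_measure)
    have "enat ?D \<le> gen_time G {} x"
      unfolding gen_time_def
    proof (rule INF_greatest)
      fix k assume "k \<in> {n. 1 \<le> n \<and> generate G ({} \<union> x ` {1..n}) = carrier G}"
      then have k: "generate G (x ` {1..k}) = carrier G" by auto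
      show "enat ?D \<le> enat k"
      proof (rule ccontr)
        assume "\<not> enat ?D \<le> enat k"
        then have kD: "k \<le> ?D" by simp
        have sub: "x ` {1..?D} \<subseteq> carrier G" using xc by (auto simp: PiE_iff)
        have "generate G (x ` {1..k}) \<subseteq> generate G (x ` {1..?D})"
          by (rule mono_generate) (use kD in auto)
        with k generate_incl[OF sub] have "generate G (x ` {1..?D}) = carrier G" by auto
        then have "restrict x {1..?D} \<in> E" using sub by (auto simp: E_def)
        moreover have "x \<in> F (restrict x {1..?D})"
          using xc by (auto simp: F_def prod_emb_def space_uniform_count_measure PiE_iff)
        ultimately show False using False by blast
      qed
    qed
    then have "ennreal_of_enat (enat ?D) \<le> ennreal_of_enat (gen_time G {} x)"
      by (simp only: ennreal_of_enat_le_iff)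
    then show ?thesis using False x by simp
  qed simp
  have "of_nat n = of_nat ?D * ennreal (1/2)"
  proof -
    have "ennreal (real n) = ennreal (real ?D * (1/2))" by simp
    also have "\<dots> = ennreal (real ?D) * ennreal (1/2)" by (rule ennreal_mult) auto
    finally show ?thesis by (simp only: ennreal_of_nat_eq_real_of_nat)
  qed
  also have "\<dots> \<le> of_nat ?D * emeasure (unif_seq G) (space (unif_seq G) - ?B)"
    by (intro mult_left_mono half) auto
  also have "\<dots> = (\<integral>\<^sup>+ x. of_nat ?D * indicator (space (unif_seq G) - ?B) x \<partial>unif_seq G)"
    using Bs by (subst nn_integral_cmult_indicator) auto
  also have "\<dots> \<le> exp_gen_time G {}"
    unfolding exp_gen_time_def by (intro nn_integral_mono lower)
  finally show ?thesis .
qed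

section \<open>Transport to a group on the natural numbers\<close>

lemma exists_iso_nat_group:
  assumes "group G" "finite (carrier G)"
  obtains H :: "nat monoid" and \<phi> where "group H" "\<phi> \<in> iso G H"
proof -
  interpret group G by fact
  obtain \<phi> :: "'a \<Rightarrow> nat" where inj: "inj_on \<phi> (carrier G)"
    using finite_imp_inj_to_nat_seg[OF assms(2)] by metis
  define \<psi> where "\<psi> = the_inv_into (carrier G) \<phi>"
  have psi[simp]: "\<psi> (\<phi> x) = x" if "x \<in> carrier G" for x
    using that inj by (simp add: \<psi>_def the_inv_into_f_f)
  define H :: "nat monoid" where
    "H = \<lparr>carrier = \<phi> ` carrier G, mult = (\<lambda>a b. \<phi> (\<psi> a \<otimes>\<^bsub>G\<^esub> \<psi> b)), one = \<phi> \<one>\<^bsub>G\<^esub>\<rparr>"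
  have H: "group H"
  proof (rule groupI)
    fix x assume "x \<in> carrier H"
    then obtain a where a: "a \<in> carrier G" "x = \<phi> a" by (auto simp: H_def)
    then show "\<exists>y\<in>carrier H. y \<otimes>\<^bsub>H\<^esub> x = \<one>\<^bsub>H\<^esub>"
      by (intro bexI[of _ "\<phi> (inv\<^bsub>G\<^esub> a)"]) (auto simp: H_def)
  qed (auto simp: H_def m_assoc)
  have "\<phi> \<in> iso G H"
    using inj by (auto simp: iso_def hom_def H_def bij_betw_def)
  with H show thesis by (rule that)
qed

lemma generate_iso_eq:
  assumes "group G" "group H" "\<phi> \<in> iso G H" "X \<subseteq> carrier G"
  shows "generate H (\<phi> ` X) = carrier H \<longleftrightarrow> generate G X = carrier G"
proof -
  interpret G: group G by fact
  interpret group_hom G H \<phi>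
    using assms by (auto simp: group_hom_def group_hom_axioms_def iso_def)
  have bij: "bij_betw \<phi> (carrier G) (carrier H)" using assms by (simp add: iso_def)
  have "generate H (\<phi> ` X) = \<phi> ` generate G X" by (rule generate_img[OF assms(4)])
  moreover have "\<phi> ` generate G X = \<phi> ` carrier G \<longleftrightarrow> generate G X = carrier G"
    using bij G.generate_incl[OF assms(4)] by (intro inj_on_image_eq_iff) (auto simp: bij_betw_def)
  ultimately show ?thesis using bij by (simp add: bij_betw_def)
qed

text \<open>Both counting bounds pass to an isomorphic copy. The bound \<open>bad\<close> leaves an
  \<open>x\<close> that generates together with \<open>g\<close>, whence 2-generation; the bound
  \<open>few\<close> rules out the trivial group, in which every tuple generates.\<close>

lemma exists_nat_group_if_counts:
  assumes G: "group G" "finite (carrier G)" and g: "g \<in> carrier G" and n: "n \<ge> 1"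
    and bad: "2 * card {x \<in> carrier G. generate G {x, g} \<noteq> carrier G} \<le> card (carrier G)"
    and few: "2 * card {f \<in> {1..2*n} \<rightarrow>\<^sub>E carrier G. generate G (f ` {1..2*n}) = carrier G}
      \<le> card (carrier G) ^ (2*n)"
  shows "\<exists>G :: nat monoid. group G \<and> finite (carrier G) \<and> carrier G \<noteq> {\<one>\<^bsub>G\<^esub>} \<and> two_generated G \<and>
    exp_gen_time G {} \<ge> of_nat n \<and>
    (\<exists>g\<in>carrier G. exp_gen_time G {g} \<le> 2)"
proof -
  obtain H :: "nat monoid" and \<phi> where H: "group H" and \<phi>: "\<phi> \<in> iso G H"
    using exists_iso_nat_group[OF G] .
  interpret G: group G by fact
  interpret H: group H by fact
  have bij: "bij_betw \<phi> (carrier G) (carrier H)" and inj: "inj_on \<phi> (carrier G)"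
    and im: "\<phi> ` carrier G = carrier H"
    using \<phi> by (auto simp: iso_def bij_betw_def)
  have finH: "finite (carrier H)" and cardH: "card (carrier H) = card (carrier G)"
    using bij G bij_betw_finite bij_betw_same_card by metis+
  have cpos: "card (carrier G) > 0" using G(2) by (auto simp: card_gt_0_iff)
  note gen = generate_iso_eq[OF G(1) H \<phi>]
  have "{y \<in> carrier H. generate H {y, \<phi> g} \<noteq> carrier H}
      = \<phi> ` {x \<in> carrier G. generate G {x, g} \<noteq> carrier G}"
  proof -
    have "generate H {\<phi> x, \<phi> g} = carrier H \<longleftrightarrow> generate G {x, g} = carrier G" if "x \<in> carrier G" for x
      using gen[of "{x, g}"] g that by simp
    then show ?thesis unfolding im[symmetric] by blast
  qed
  then have "card {y \<in> carrier H. generate H {y, \<phi> g} \<noteq> carrier H}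
      \<le> card {x \<in> carrier G. generate G {x, g} \<noteq> carrier G}"
    using G(2) by (simp add: card_image_le)
  then have badH: "2 * card {y \<in> carrier H. generate H {y, \<phi> g} \<noteq> carrier H} \<le> card (carrier H)"
    using bad cardH by linarith
  let ?D = "{1..2*n}"
  let ?E = "{f \<in> ?D \<rightarrow>\<^sub>E carrier G. generate G (f ` ?D) = carrier G}"
  have "{f \<in> ?D \<rightarrow>\<^sub>E carrier H. generate H (f ` ?D) = carrier H} \<subseteq> (\<lambda>f. restrict (\<phi> \<circ> f) ?D) ` ?E"
  proof
    fix f assume f: "f \<in> {f \<in> ?D \<rightarrow>\<^sub>E carrier H. generate H (f ` ?D) = carrier H}"
    define f' where "f' = restrict (the_inv_into (carrier G) \<phi> \<circ> f) ?D"
    have fi: "\<phi> (f' i) = f i" "f' i \<in> carrier G" if "i \<in> ?D" for i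
      using f that im f_the_inv_into_f[OF inj] the_inv_into_into[OF inj, of "f i" "carrier G"]
      by (auto simp: f'_def PiE_iff)
    have "f ` ?D = \<phi> ` f' ` ?D" unfolding image_image by (intro image_cong) (use fi in auto)
    moreover have "f' ` ?D \<subseteq> carrier G" using fi by auto
    ultimately have "f' \<in> ?E" using f gen[of "f' ` ?D"] fi by (auto simp: f'_def)
    moreover have "f = restrict (\<phi> \<circ> f') ?D"
      using f fi by (auto simp: fun_eq_iff PiE_iff extensional_def)
    ultimately show "f \<in> (\<lambda>f. restrict (\<phi> \<circ> f) ?D) ` ?E" by blast
  qed
  moreover have "finite ?E"
    by (rule finite_subset[of _ "?D \<rightarrow>\<^sub>E carrier G"]) (use G(2) in \<open>auto intro: finite_PiE\<close>)
  ultimately have "card {f \<in> ?D \<rightarrow>\<^sub>E carrier H. generate H (f ` ?D) = carrier H} \<le> card ?E"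
    by (meson card_image_le card_mono finite_imageI le_trans)
  then have fewH: "2 * card {f \<in> ?D \<rightarrow>\<^sub>E carrier H. generate H (f ` ?D) = carrier H} \<le> card (carrier H) ^ (2*n)"
  proof -
    assume "card {f \<in> ?D \<rightarrow>\<^sub>E carrier H. generate H (f ` ?D) = carrier H} \<le> card ?E"
    then have "2 * card {f \<in> ?D \<rightarrow>\<^sub>E carrier H. generate H (f ` ?D) = carrier H} \<le> 2 * card ?E"
      by simp
    also note few
    finally show ?thesis by (simp only: cardH)
  qed
  have \<phi>g: "\<phi> g \<in> carrier H" using im g by auto
  obtain x where x: "x \<in> carrier H" "generate H {x, \<phi> g} = carrier H"
  proof -
    have "{y \<in> carrier H. generate H {y, \<phi> g} \<noteq> carrier H} \<noteq> carrier H"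
      using badH cpos cardH by auto
    then show thesis using that by auto
  qed
  have "carrier H \<noteq> {\<one>\<^bsub>H\<^esub>}"
  proof
    assume triv: "carrier H = {\<one>\<^bsub>H\<^esub>}"
    have "generate H (f ` ?D) = carrier H" if "f \<in> ?D \<rightarrow>\<^sub>E carrier H" for f
    proof -
      have "f ` ?D \<subseteq> carrier H" using that by auto
      from H.generate_incl[OF this] show ?thesis using triv generate.one by fastforce
    qed
    then have "{f \<in> ?D \<rightarrow>\<^sub>E carrier H. generate H (f ` ?D) = carrier H} = (?D \<rightarrow>\<^sub>E carrier H)"
      by auto
    then have "card {f \<in> ?D \<rightarrow>\<^sub>E carrier H. generate H (f ` ?D) = carrier H} = card (carrier H) ^ (2*n)"
      by (simp add: card_PiE)
    then show False using fewH cpos cardH by simp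
  qed
  moreover have "two_generated H" unfolding two_generated_def using x \<phi>g by blast
  moreover have "exp_gen_time H {} \<ge> of_nat n" by (rule exp_gen_time_ge[OF H finH fewH])
  moreover have "exp_gen_time H {\<phi> g} \<le> 2"
    by (rule exp_gen_time_le_2[OF H finH _ badH]) (use \<phi>g in auto)
  ultimately show ?thesis using H finH \<phi>g by blast
qed

section \<open>Subgroups of powers of alternating groups\<close>

text \<open>The commutator of an element of \<open>K\<close> trivial on \<open>J\<close> with one
  trivial at \<open>j\<close> is trivial on \<open>insert j J\<close>, and perfectness lets such
  commutators fill coordinate \<open>i\<close>. So \<open>K\<close> contains every element supported
  on one coordinate, and any tuple can be matched one coordinate at a time.\<close>

lemma subgroup_product_group_eq_carrier:
  assumes S: "group S" and perfect: "derived S (carrier S) = carrier S"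
    and I: "finite I" "card I \<ge> 2"
    and K: "subgroup K (product_group I (\<lambda>_. S))"
    and pair: "\<And>i j s. i \<in> I \<Longrightarrow> j \<in> I \<Longrightarrow> i \<noteq> j \<Longrightarrow> s \<in> carrier S \<Longrightarrow>
      \<exists>f\<in>K. f i = s \<and> f j = \<one>\<^bsub>S\<^esub>"
  shows "K = carrier (product_group I (\<lambda>_. S))"
proof -
  interpret S: group S by fact
  let ?G = "product_group I (\<lambda>_. S)"
  interpret G: group ?G by (simp add: S)
  interpret K: subgroup K ?G by fact
  have KI: "f \<in> (\<Pi>\<^sub>E i\<in>I. carrier S)" if "f \<in> K" for f
    using K.subset that by auto
  have Kc: "f i \<in> carrier S" if "f \<in> K" "i \<in> I" for f i
    using KI[OF that(1)] that(2) by auto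
  have Kinv: "(\<lambda>i\<in>I. inv\<^bsub>S\<^esub> f i) \<in> K" if "f \<in> K" for f
    using K.m_inv_closed[OF that] KI[OF that] S by simp
  have Kmult: "(\<lambda>i\<in>I. f i \<otimes>\<^bsub>S\<^esub> g i) \<in> K" if "f \<in> K" "g \<in> K" for f g
    using K.m_closed[OF that] by simp
  have isolate: "\<exists>f\<in>K. f i = s \<and> (\<forall>j\<in>J. f j = \<one>\<^bsub>S\<^esub>)"
    if "finite J" "J \<noteq> {}" "J \<subseteq> I - {i}" "i \<in> I" "s \<in> carrier S" for J i s
    using that
  proof (induction J arbitrary: s rule: finite_ne_induct)
    case (singleton j)
    then show ?case using pair[of i j s] by auto
  next
    case (insert j J)
    \<comment> \<open>As \<open>L\<close> is a subgroup and \<open>S\<close> is its own derived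
      subgroup, it is enough that \<open>L\<close> contains all commutators.\<close>
    define L where "L = {f i | f. f \<in> K \<and> (\<forall>j'\<in>insert j J. f j' = \<one>\<^bsub>S\<^esub>)}"
    have jI: "j \<in> I" "i \<noteq> j" "J \<subseteq> I" using insert.prems by auto
    have L: "subgroup L S"
    proof (rule S.subgroupI)
      show "L \<subseteq> carrier S" using Kc insert.prems by (auto simp: L_def)
      have "(\<lambda>i\<in>I. \<one>\<^bsub>S\<^esub>) \<in> K" using K.one_closed by simp
      then have "\<one>\<^bsub>S\<^esub> \<in> L" unfolding L_def using jI insert.prems
        by (intro CollectI exI[of _ "\<lambda>i\<in>I. \<one>\<^bsub>S\<^esub>"]) auto
      then show "L \<noteq> {}" by auto
      show "inv\<^bsub>S\<^esub> a \<in> L" if "a \<in> L" for a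
      proof -
        from that obtain f where f: "f \<in> K" "\<forall>j'\<in>insert j J. f j' = \<one>\<^bsub>S\<^esub>" "a = f i" by (auto simp: L_def)
        then show ?thesis unfolding L_def
          using Kinv[OF f(1)] jI insert.prems
          by (intro CollectI exI[of _ "\<lambda>i\<in>I. inv\<^bsub>S\<^esub> f i"]) auto
      qed
      show "a \<otimes>\<^bsub>S\<^esub> b \<in> L" if "a \<in> L" "b \<in> L" for a b
      proof -
        from that obtain f g where f: "f \<in> K" "\<forall>j'\<in>insert j J. f j' = \<one>\<^bsub>S\<^esub>" "a = f i"
          and g: "g \<in> K" "\<forall>j'\<in>insert j J. g j' = \<one>\<^bsub>S\<^esub>" "b = g i" by (auto simp: L_def)
        then show ?thesis unfolding L_def
          using Kmult[OF f(1) g(1)] jI insert.prems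
          by (intro CollectI exI[of _ "\<lambda>i\<in>I. f i \<otimes>\<^bsub>S\<^esub> g i"]) auto
      qed
    qed
    have "derived_set S (carrier S) \<subseteq> L"
    proof
      fix c assume "c \<in> derived_set S (carrier S)"
      then obtain a b where ab: "a \<in> carrier S" "b \<in> carrier S"
        and c: "c = a \<otimes>\<^bsub>S\<^esub> b \<otimes>\<^bsub>S\<^esub> inv\<^bsub>S\<^esub> a \<otimes>\<^bsub>S\<^esub> inv\<^bsub>S\<^esub> b" by auto
      obtain f where f: "f \<in> K" "f i = a" "\<forall>j\<in>J. f j = \<one>\<^bsub>S\<^esub>"
        using insert.IH[of a] insert.prems ab by auto
      obtain g where g: "g \<in> K" "g i = b" "g j = \<one>\<^bsub>S\<^esub>"
        using pair[of i j b] insert.prems ab jI by auto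
      define h where "h = (\<lambda>i\<in>I. f i \<otimes>\<^bsub>S\<^esub> g i \<otimes>\<^bsub>S\<^esub> inv\<^bsub>S\<^esub> f i \<otimes>\<^bsub>S\<^esub> inv\<^bsub>S\<^esub> g i)"
      have "h \<in> K"
        using Kmult[OF Kmult[OF Kmult[OF f(1) g(1)] Kinv[OF f(1)]] Kinv[OF g(1)]]
        by (simp add: h_def cong: restrict_cong)
      moreover have "h i = c" using f g c insert.prems by (simp add: h_def)
      moreover have "h j' = \<one>\<^bsub>S\<^esub>" if "j' \<in> insert j J" for j'
        using that f g jI Kc[OF f(1)] Kc[OF g(1)] by (auto simp: h_def)
      ultimately show "c \<in> L" unfolding L_def by blast
    qed
    then have "derived S (carrier S) \<subseteq> L"
      unfolding derived_def by (rule S.generate_subgroup_incl[OF _ L])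
    then have "s \<in> L" using perfect insert.prems by auto
    then show ?case by (auto simp: L_def)
  qed
  have approx: "\<exists>f'\<in>K. \<forall>j\<in>J. f' j = f j" if "finite J" "J \<subseteq> I" "f \<in> carrier ?G" for J f
    using that
  proof (induction J rule: finite_induct)
    case empty
    then show ?case using K.one_closed by auto
  next
    case (insert i J)
    then obtain f' where f': "f' \<in> K" "\<forall>j\<in>J. f' j = f j" by auto
    have fi: "f i \<in> carrier S" "f' i \<in> carrier S" using insert.prems Kc[OF f'(1)] by auto
    \<comment> \<open>The fact \<open>isolate\<close> needs a nonempty set of coordinates; this is
      where \<open>card I \<ge> 2\<close> enters.\<close>
    have "I - {i} \<noteq> {}"
    proof
      assume "I - {i} = {}"
      then have "card I \<le> card {i}" by (intro card_mono) auto
      then show False using I(2) by simp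
    qed
    \<comment> \<open>Multiplication by \<open>e\<close> corrects coordinate \<open>i\<close> and
      leaves the coordinates in \<open>J\<close> alone.\<close>
    then obtain e where e: "e \<in> K" "e i = inv\<^bsub>S\<^esub> f' i \<otimes>\<^bsub>S\<^esub> f i" "\<forall>j\<in>I - {i}. e j = \<one>\<^bsub>S\<^esub>"
      using isolate[of "I - {i}" i "inv\<^bsub>S\<^esub> f' i \<otimes>\<^bsub>S\<^esub> f i"] I insert.prems fi by auto
    have "(\<lambda>i\<in>I. f' i \<otimes>\<^bsub>S\<^esub> e i) \<in> K" by (rule Kmult[OF f'(1) e(1)])
    moreover have "(\<lambda>i\<in>I. f' i \<otimes>\<^bsub>S\<^esub> e i) j = f j" if "j \<in> insert i J" for j
    proof (cases "j = i")
      case True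
      then show ?thesis using insert.prems e(2) fi
        by (simp add: S.m_assoc[symmetric])
    next
      case False
      then show ?thesis using that insert.prems e(3) f' Kc[OF f'(1), of j] by auto
    qed
    ultimately show ?case by blast
  qed
  show ?thesis
  proof
    show "K \<subseteq> carrier ?G" by (rule K.subset)
    show "carrier ?G \<subseteq> K"
    proof
      fix f assume f: "f \<in> carrier ?G"
      obtain f' where f': "f' \<in> K" "\<forall>j\<in>I. f' j = f j" using approx[OF I(1) _ f] by auto
      have "f' = f" using f KI[OF f'(1)] f'(2) by (intro PiE_ext[of f' I "\<lambda>_. carrier S" f]) auto
      then show "f \<in> K" using f' by simp
    qed
  qed
qed

section \<open>Three-cycles and commutators of permutations\<close>

lemma three_cycle_apply:
  assumes "distinct [a, b, c]"
  shows "cycle_of_list [a, b, c] a = b" "cycle_of_list [a, b, c] b = c" "cycle_of_list [a, b, c] c = a"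
    "x \<notin> {a, b, c} \<Longrightarrow> cycle_of_list [a, b, c] x = x"
  using assms by (auto simp: Transposition.transpose_def)

lemma three_cycle_rotate:
  "distinct [a, b, c] \<Longrightarrow> cycle_of_list [a, b, c] = cycle_of_list [b, c, a]"
  by (auto simp: Transposition.transpose_def fun_eq_iff)

lemma inv_three_cycle:
  assumes "distinct [a, b, c]"
  shows "inv' (cycle_of_list [a, b, c]) = cycle_of_list [a, c, b]"
  by (rule inv_unique_comp) (use assms in \<open>auto simp: Transposition.transpose_def fun_eq_iff\<close>)

text \<open>Since the supports meet only in \<open>a\<close>, \<open>q\<close> fixes
  \<open>p a\<close> and \<open>p\<close> fixes \<open>q a\<close>. Following the points then gives
  the cycle through \<open>a\<close>, \<open>p a\<close>, \<open>q a\<close>, and at every other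
  point the factors cancel.\<close>

lemma commutator_three_cycle:
  assumes p: "bij p" and q: "bij q"
    and a: "p a \<noteq> a" "q a \<noteq> a" and only: "\<And>z. p z \<noteq> z \<Longrightarrow> q z \<noteq> z \<Longrightarrow> z = a"
  shows "p \<circ> q \<circ> inv' p \<circ> inv' q = cycle_of_list [a, p a, q a]"
proof
  fix z
  have ppa: "p (p a) \<noteq> p a" and qqa: "q (q a) \<noteq> q a"
    using a p q by (metis bij_is_inj injD)+
  have qpa: "q (p a) = p a" using only[of "p a"] ppa a by auto
  have pqa: "p (q a) = q a" using only[of "q a"] qqa a by auto
  have pq: "p a \<noteq> q a" using ppa pqa by auto
  have ip: "inv' p (p x) = x" and iq: "inv' q (q x) = x" for x
    using p q by (simp_all add: bij_is_inj)
  have pi: "p (inv' p x) = x" and qi: "q (inv' q x) = x" for x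
    using p q by (simp_all add: bij_is_surj surj_f_inv_f)
  have d: "distinct [a, p a, q a]" using a pq by auto
  consider "z = a" | "z = p a" | "z = q a" | "z \<notin> {a, p a, q a}" by blast
  then show "(p \<circ> q \<circ> inv' p \<circ> inv' q) z = cycle_of_list [a, p a, q a] z"
  proof cases
    case 1
    have b: "p (inv' q a) = inv' q a"
      using only[of "inv' q a"] qi[of a] a by force
    then have "inv' p (inv' q a) = inv' q a" by (metis ip)
    then show ?thesis using 1 three_cycle_apply(1)[OF d] qi by simp
  next
    case 2
    have "inv' q (p a) = p a" using qpa by (metis iq)
    then show ?thesis using 2 three_cycle_apply(2)[OF d] ip pqa by simp
  next
    case 3
    have "q (inv' p a) = inv' p a"
      using only[of "inv' p a"] pi[of a] a by force
    then show ?thesis using 3 three_cycle_apply(3)[OF d] iq pi by simp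
  next
    case 4
    have "p (q (inv' p (inv' q z))) = z"
    proof (cases "q z = z")
      case True
      then have z: "inv' q z = z" by (metis iq)
      have "q (inv' p z) = inv' p z"
      proof (rule ccontr)
        assume n: "q (inv' p z) \<noteq> inv' p z"
        then have "p z \<noteq> z" using True by (metis ip)
        then have "p (inv' p z) \<noteq> inv' p z" using pi by (metis ip)
        then have "inv' p z = a" using only n by blast
        then show False using 4 pi[of z] by auto
      qed
      then show ?thesis using z pi by simp
    next
      case False
      then have pz: "p z = z" using only 4 by blast
      have n: "q (inv' q z) \<noteq> inv' q z" using False qi by metis
      have "p (inv' q z) = inv' q z"
      proof (rule ccontr)
        assume "p (inv' q z) \<noteq> inv' q z"
        then have "inv' q z = a" using only n by blast
        then show False using 4 qi[of z] by auto
      qed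
      then have "inv' p (inv' q z) = inv' q z" by (metis ip)
      then show ?thesis using qi pz by simp
    qed
    then show ?thesis using three_cycle_apply(4)[OF d 4] by simp
  qed
qed

text \<open>Permutations with disjoint supports commute.\<close>

lemma commutator_disjoint:
  assumes p: "bij p" and q: "bij q" and disj: "\<And>z. p z = z \<or> q z = z"
  shows "p \<circ> q \<circ> inv' p \<circ> inv' q = id"
proof -
  have "p (q z) = q (p z)" for z
  proof (cases "p z = z")
    case True
    show ?thesis
    proof (cases "q z = z")
      case False
      then have "q (q z) \<noteq> q z" using q by (metis bij_is_inj injD)
      then show ?thesis using disj[of "q z"] True by auto
    qed (use True in auto)
  next
    case False
    then have "p (p z) \<noteq> p z" using p by (metis bij_is_inj injD)
    then show ?thesis using disj[of "p z"] disj[of z] False by auto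
  qed
  then have "p \<circ> q = q \<circ> p" by (simp add: fun_eq_iff)
  then have "p \<circ> q \<circ> inv' p \<circ> inv' q = q \<circ> (p \<circ> inv' p) \<circ> inv' q" by (simp add: comp_assoc)
  also have "\<dots> = id" using p q by (metis bij_is_surj comp_id surj_iff)
  finally show ?thesis .
qed

lemma conj_three_cycle:
  assumes "bij \<sigma>" "distinct [a, b, c]"
  shows "\<sigma> \<circ> cycle_of_list [a, b, c] \<circ> inv' \<sigma> = cycle_of_list [\<sigma> a, \<sigma> b, \<sigma> c]"
  using conjugation_of_cycle[OF assms(2,1)] by (simp del: cycle_of_list.simps)

text \<open>Conjugating the cycle (e f j) by (e i f) gives (i e j), and by (e f i) gives (f i j);
  conjugating (e j k) by (e i f) gives (i j k). Rotations and inverses supply the other orders of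
  the entries. The set \<open>L\<close> is only assumed closed under composition and inverses, so
  that the fact applies to any subgroup of permutations.\<close>

lemma three_cycles_star:
  assumes comp: "\<And>p q. p \<in> L \<Longrightarrow> q \<in> L \<Longrightarrow> p \<circ> q \<in> L" and inv: "\<And>p. p \<in> L \<Longrightarrow> inv' p \<in> L"
    and ef: "e \<noteq> f" and star: "\<And>z. z \<in> X \<Longrightarrow> z \<noteq> e \<Longrightarrow> z \<noteq> f \<Longrightarrow> cycle_of_list [e, f, z] \<in> L"
    and xyz: "distinct [x, y, z]" "{x, y, z} \<subseteq> X"
  shows "cycle_of_list [x, y, z] \<in> L"
proof -
  define P where "P a b c \<longleftrightarrow> cycle_of_list [a, b, c] \<in> L" for a b c
  have rot: "P b c a" if "P a b c" "distinct [a, b, c]" for a b c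
    using that three_cycle_rotate[of a b c] unfolding P_def by simp
  have flip: "P a c b" if "P a b c" "distinct [a, b, c]" for a b c
    using inv[of "cycle_of_list [a, b, c]"] that inv_three_cycle[of a b c] unfolding P_def by metis
  have conj: "P (\<sigma> a) (\<sigma> b) (\<sigma> c)" if "P a b c" "distinct [a, b, c]" "\<sigma> \<in> L" "bij \<sigma>" for a b c \<sigma>
    using comp[OF comp[OF that(3)] inv[OF that(3)]] that conj_three_cycle[OF that(4,2)]
    unfolding P_def by metis
  have bij3: "bij (cycle_of_list cs)" for cs :: "'a list"
    using cycle_permutes permutes_bij by blast
  have P0: "P e f i" if "i \<in> X" "i \<noteq> e" "i \<noteq> f" for i
    using star that by (simp add: P_def)
  have P0': "P e i f" if "i \<in> X" "i \<noteq> e" "i \<noteq> f" for i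
    using flip[OF P0] that ef by auto
  have P1: "P i e j" if "i \<in> X" "j \<in> X" "i \<notin> {e, f}" "j \<notin> {e, f}" "i \<noteq> j" for i j
  proof -
    have d: "distinct [e, i, f]" using that ef by auto
    have "P (cycle_of_list [e, i, f] e) (cycle_of_list [e, i, f] f) (cycle_of_list [e, i, f] j)"
      using P0'[of i] that ef by (intro conj[OF P0 _ _ bij3]) (auto simp: P_def simp del: cycle_of_list.simps)
    then show ?thesis using three_cycle_apply[OF d] that by (simp del: cycle_of_list.simps)
  qed
  have P2: "P f i j" if "i \<in> X" "j \<in> X" "i \<notin> {e, f}" "j \<notin> {e, f}" "i \<noteq> j" for i j
  proof -
    have d: "distinct [e, f, i]" using that ef by auto
    have "P (cycle_of_list [e, f, i] e) (cycle_of_list [e, f, i] f) (cycle_of_list [e, f, i] j)"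
      using P0[of i] that ef by (intro conj[OF P0 _ _ bij3]) (auto simp: P_def simp del: cycle_of_list.simps)
    then show ?thesis using three_cycle_apply[OF d] that by (simp del: cycle_of_list.simps)
  qed
  have P3: "P i j k" if "i \<in> X" "j \<in> X" "k \<in> X" "i \<notin> {e, f}" "j \<notin> {e, f}" "k \<notin> {e, f}"
    "distinct [i, j, k]" for i j k
  proof -
    have d: "distinct [e, i, f]" using that ef by auto
    have "P e j k" using rot[OF P1[of k j]] that by auto
    then have "P (cycle_of_list [e, i, f] e) (cycle_of_list [e, i, f] j) (cycle_of_list [e, i, f] k)"
      using P0'[of i] that ef by (intro conj[OF _ _ _ bij3]) (auto simp: P_def simp del: cycle_of_list.simps)
    then show ?thesis
      using three_cycle_apply(1)[OF d] three_cycle_apply(4)[OF d, of j] three_cycle_apply(4)[OF d, of k] that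
      by (auto simp del: cycle_of_list.simps)
  qed
  \<comment> \<open>The cases are sorted by how many of the three entries lie in
    \<open>{e, f}\<close>: \<open>2\<close> covers two of them, \<open>1\<close> covers one, and
    \<open>P3\<close> covers none.\<close>
  have 2: "P e f i \<and> P f i e \<and> P i e f \<and> P e i f \<and> P i f e \<and> P f e i"
    if i: "i \<in> X" "i \<noteq> e" "i \<noteq> f" for i
  proof -
    have d: "distinct [e, f, i]" "distinct [f, i, e]" "distinct [e, i, f]" "distinct [i, f, e]"
      using i ef by auto
    note a1 = P0[OF i] and b1 = P0'[OF i]
    note a2 = rot[OF a1 d(1)] and b2 = rot[OF b1 d(3)]
    note a3 = rot[OF a2 d(2)] and b3 = rot[OF b2 d(4)]
    show ?thesis using a1 a2 a3 b1 b2 b3 by blast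
  qed
  have 1: "P i e j \<and> P e i j \<and> P i j e \<and> P i f j \<and> P f i j \<and> P i j f"
    if ij: "i \<in> X" "j \<in> X" "i \<notin> {e, f}" "j \<notin> {e, f}" "i \<noteq> j" for i j
  proof -
    have d: "distinct [j, e, i]" "distinct [e, i, j]" "distinct [f, i, j]" "distinct [f, j, i]"
      "distinct [j, i, f]"
      using ij by auto
    note c1 = P1[OF ij] and c2 = rot[OF P1[of j i] d(1)] and d1 = P2[OF ij] and d2 = P2[of j i]
    have "P e i j" using c2 ij by auto
    moreover have "P i j e" using rot[OF calculation d(2)] .
    moreover have "P i j f" using rot[OF d1 d(3)] .
    moreover have "P f j i" using d2 ij by auto
    then have "P j i f" using rot d(4) by blast
    then have "P i f j" using rot d(5) by blast
    ultimately show ?thesis using c1 d1 by blast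
  qed
  have xyz': "x \<in> X" "y \<in> X" "z \<in> X" "x \<noteq> y" "y \<noteq> z" "x \<noteq> z" using xyz by auto
  have "P x y z"
  proof (cases "x \<in> {e, f}")
    case x: True
    show ?thesis
    proof (cases "y \<in> {e, f}")
      case True
      then show ?thesis using x xyz' 2[of z] by blast
    next
      case y: False
      show ?thesis
      proof (cases "z \<in> {e, f}")
        case True
        then show ?thesis using x y xyz' 2[of y] by blast
      next
        case False
        then show ?thesis using x y xyz' 1[of y z] by blast
      qed
    qed
  next
    case x: False
    show ?thesis
    proof (cases "y \<in> {e, f}")
      case y: True
      show ?thesis
      proof (cases "z \<in> {e, f}")
        case True
        then show ?thesis using x y xyz' 2[of x] by blast
      next
        case False
        then show ?thesis using x y xyz' 1[of x z] by blast
      qed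
    next
      case y: False
      show ?thesis
      proof (cases "z \<in> {e, f}")
        case True
        then show ?thesis using x y xyz' 1[of x y] by blast
      next
        case False
        then show ?thesis using x y xyz' P3[of x y z] by simp
      qed
    qed
  qed
  then show ?thesis by (simp only: P_def)
qed

section \<open>Powers of the cycle on an interval of natural numbers\<close>

definition rot :: "nat \<Rightarrow> nat \<Rightarrow> nat \<Rightarrow> nat \<Rightarrow> nat" where
  "rot a L t z = (if a \<le> z \<and> z < a + L then a + (z - a + t) mod L else z)"

lemma rot_fixes: "z \<notin> {a..<a + L} \<Longrightarrow> rot a L t z = z"
  by (auto simp: rot_def)

lemma rot_in: "z \<in> {a..<a + L} \<Longrightarrow> rot a L t z \<in> {a..<a + L}"
  by (auto simp: rot_def)

lemma rot_add: "rot a L s \<circ> rot a L t = rot a L (s + t)"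
proof
  fix z
  show "(rot a L s \<circ> rot a L t) z = rot a L (s + t) z"
  proof (cases "a \<le> z \<and> z < a + L")
    case True
    then obtain d where "z = a + d" "d < L"
      by (metis add_less_cancel_left le_iff_add)
    then show ?thesis by (simp add: rot_def mod_simps ac_simps)
  qed (auto simp: rot_def)
qed

lemma rot_mod: "rot a L t = rot a L (t mod L)"
  unfolding rot_def by (simp only: mod_add_right_eq)

lemma rot_0 [simp]: "rot a L 0 = id"
  by (auto simp: rot_def fun_eq_iff)

lemma rot_transitive:
  assumes "z \<in> {a..<a + L}" "z' \<in> {a..<a + L}"
  obtains t where "t < L" "rot a L t z = z'"
proof
  have L: "L > 0" using assms by auto
  \<comment> \<open>Adding \<open>L\<close> first keeps the subtraction of naturals from
    truncating.\<close>
  show "(z' + L - z) mod L < L" using L by simp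
  have "(z - a + (z' + L - z)) = z' - a + L" using assms by auto
  then have "(z - a + (z' + L - z) mod L) mod L = (z' - a) mod L"
    by (metis mod_add_right_eq mod_add_self2)
  then show "rot a L ((z' + L - z) mod L) z = z'"
    using assms by (auto simp: rot_def)
qed

lemma rot_free:
  assumes "z \<in> {a..<a + L}" "rot a L s z = rot a L t z"
  shows "s mod L = t mod L"
proof -
  have "(z - a + s) mod L = (z - a + t) mod L" using assms by (auto simp: rot_def)
  then show ?thesis by (simp add: nat_mod_eq_iff)
qed

lemma bij_rot: "bij (rot a L t)"
proof (rule o_bij)
  \<comment> \<open>The shift by \<open>L - t mod L\<close> is inverse to the shift by
    \<open>t\<close>; for \<open>L = 0\<close> all shifts are the identity.\<close>
  have "(L - t mod L + t) mod L = 0" if "L > 0"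
    using that mod_le_divisor[of L t] by (metis le_add_diff_inverse2 mod_add_right_eq mod_self
        mod_less_divisor less_imp_le)
  then have "rot a L (L - t mod L + t) = id"
    using rot_mod[of a L "L - t mod L + t"] by (cases "L = 0") (auto simp: rot_def fun_eq_iff)
  then show "rot a L (L - t mod L) \<circ> rot a L t = id" "rot a L t \<circ> rot a L (L - t mod L) = id"
    by (simp_all add: rot_add add.commute)
qed

lemma rot_permutes: "rot a L t permutes {a..<a + L}"
  unfolding permutes_def using bij_rot[of a L t, unfolded bij_iff] rot_fixes by blast

text \<open>With \<open>L = 2 * l + 1\<close>, the number \<open>l + 1\<close> is an inverse of 2
  modulo \<open>L\<close>. So the shift by \<open>t\<close> is the square of the shift by
  \<open>t * (l + 1)\<close>, and squares are even.\<close>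

lemma evenperm_rot:
  assumes "odd L"
  shows "evenperm (rot a L t)"
proof -
  obtain l where l: "L = 2 * l + 1" using assms by (rule oddE)
  define s where "s = t * (l + 1)"
  have "s + s = t + L * t" by (simp add: s_def l algebra_simps)
  then have "(s + s) mod L = t mod L" by simp
  then have "rot a L t = rot a L s \<circ> rot a L s" unfolding rot_add by (metis rot_mod)
  moreover have "permutation (rot a L s)"
    using rot_permutes[of a L s] by (auto simp: permutation_permutes)
  ultimately show ?thesis by (simp add: evenperm_comp)
qed

text \<open>The condition \<open>M mod Q = 1\<close> makes the \<open>M\<close>-th power of the product of the two cycles equal to the
  cycle on \<open>A\<close>.\<close>

locale rotations =
  fixes Q M m :: nat and A Z :: "nat set"
  assumes Q: "odd Q" "Q \<ge> 2" and M: "odd M" "M \<ge> 2" "M mod Q = 1"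
  defines "m \<equiv> Q + M" and "A \<equiv> {1..<1 + Q}" and "Z \<equiv> {Suc Q..<Suc Q + M}"
begin

abbreviation h where "h s \<equiv> rot 1 Q s"
abbreviation w where "w u \<equiv> rot (Suc Q) M u"

lemma AZ: "A \<inter> Z = {}" "A \<union> Z = {1..m}" "finite A" "finite Z" "card A = Q" "card Z = M"
  by (auto simp: A_def Z_def m_def)

lemma h_alt: "h s \<in> carrier (alt_group m)"
  unfolding alt_group_carrier
  by (intro conjI evenperm_rot[OF Q(1)] permutes_subset[OF rot_permutes]) (auto simp: m_def)

lemma w_alt: "w s \<in> carrier (alt_group m)"
  unfolding alt_group_carrier
  by (intro conjI evenperm_rot[OF M(1)] permutes_subset[OF rot_permutes]) (auto simp: m_def)

lemma alt_bij: "p \<in> carrier (alt_group m) \<Longrightarrow> bij p"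
  by (auto simp: alt_group_carrier permutes_bij)

lemma alt_perm: "p \<in> carrier (alt_group m) \<Longrightarrow> p permutes {1..m}"
  by (auto simp: alt_group_carrier)

lemma h_moves: "h 1 z \<noteq> z \<longleftrightarrow> z \<in> A"
proof
  assume "z \<in> A"
  then show "h 1 z \<noteq> z" using Q(2)
    by (cases "z = Q") (auto simp: rot_def A_def)
next
  assume "h 1 z \<noteq> z"
  then show "z \<in> A" unfolding A_def using rot_fixes by blast
qed

text \<open>Conjugation by \<open>w\<close> moves the third point of the given cycle through all of
  \<open>Z\<close>, and conjugation by \<open>h\<close> moves the pair in \<open>A\<close>. This
  yields stars of 3-cycles, hence all 3-cycles, which generate the alternating group.\<close>

lemma alt_group_eqI:
  assumes L: "subgroup L (alt_group m)"
    and conj: "\<And>p s. p \<in> L \<Longrightarrow> h s \<circ> p \<circ> inv' (h s) \<in> L" "\<And>p u. p \<in> L \<Longrightarrow> w u \<circ> p \<circ> inv' (w u) \<in> L"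
    and c: "cycle_of_list [a, a', z] \<in> L" "a \<in> A" "a' \<in> A" "a \<noteq> a'" "z \<in> Z"
  shows "L = carrier (alt_group m)"
proof -
  interpret L: subgroup L "alt_group m" by fact
  interpret S: group "alt_group m" by (rule alt_group_is_group)
  have comp: "p \<circ> q \<in> L" if "p \<in> L" "q \<in> L" for p q
    using L.m_closed[OF that] by (simp add: alt_group_mult)
  have inv: "inv' p \<in> L" if "p \<in> L" for p
    using L.m_inv_closed[OF that] L.subset that by (auto simp: alt_group_inv_equality)
  have fixA: "w u x = x" if "x \<in> A" for x u
    using that by (intro rot_fixes) (auto simp: A_def)
  have fixZ: "h u x = x" if "x \<in> Z" for x u
    using that by (intro rot_fixes) (auto simp: Z_def)
  have hA: "h s x \<in> A" if "x \<in> A" for s x using rot_in[of x 1 Q s] that by (simp add: A_def)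
  have 1: "cycle_of_list [a, a', z'] \<in> L" if z': "z' \<in> Z" for z'
  proof -
    obtain u where u: "w u z = z'" using rot_transitive[of z "Suc Q" M z'] c(5) z' by (auto simp: Z_def)
    have "distinct [a, a', z]" using c AZ(1) by auto
    from conj_three_cycle[OF bij_rot this, of "Suc Q" M u] conj(2)[OF c(1), of u]
    show ?thesis using c fixA u by (simp del: cycle_of_list.simps)
  qed
  have 2: "cycle_of_list [h s a, h s a', z'] \<in> L" if z': "z' \<in> Z" for s z'
  proof -
    have "distinct [a, a', z']" using c AZ(1) z' by auto
    from conj_three_cycle[OF bij_rot this, of 1 Q s] conj(1)[OF 1[OF z'], of s]
    show ?thesis using fixZ z' by (simp del: cycle_of_list.simps)
  qed
  have 3: "cycle_of_list [x, y, y'] \<in> L"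
    if "distinct [x, y, y']" "{x, y, y'} \<subseteq> {h s a, h s a'} \<union> Z" for s x y y'
  proof (rule three_cycles_star[OF comp inv _ _ that])
    show "h s a \<noteq> h s a'" using c bij_rot by (metis bij_is_inj injD)
  qed (use 2 in auto)
  \<comment> \<open>The pair in \<open>A\<close> moves only jointly, so its stars reach just two
    points of \<open>A\<close> at a time. A centre inside \<open>Z\<close> is common to all of them
    and connects to every point.\<close>
  define e f where "e = Suc Q" and "f = Suc (Suc Q)"
  have ef: "e \<in> Z" "f \<in> Z" "e \<noteq> f" using M by (auto simp: e_def f_def Z_def)
  have 4: "cycle_of_list [e, f, x] \<in> L" if x: "x \<in> A \<union> Z" "x \<noteq> e" "x \<noteq> f" for x
  proof (cases "x \<in> A")
    case True
    then obtain s where "h s a = x" using rot_transitive[of a 1 Q x] c(2) by (auto simp: A_def)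
    then show ?thesis using 3[of e f x s] ef x by auto
  next
    case False
    then show ?thesis using 3[of e f x 0] ef x by auto
  qed
  have "three_cycles m \<subseteq> L"
  proof
    fix p assume "p \<in> three_cycles m"
    then obtain cs where cs: "p = cycle_of_list cs" "distinct cs" "length cs = 3" "set cs \<subseteq> {1..m}" by auto
    obtain x y y' where cs': "cs = [x, y, y']" using stupid_lemma[OF cs(3)] by blast
    have "cycle_of_list [x, y, y'] \<in> L"
    proof (rule three_cycles_star[OF comp inv ef(3)])
      show "cycle_of_list [e, f, z] \<in> L" if "z \<in> {1..m}" "z \<noteq> e" "z \<noteq> f" for z
        using 4[of z] that AZ(2) by blast
    qed (use cs cs' in auto)
    then show "p \<in> L" using cs cs' by simp
  qed
  then have "carrier (alt_group m) \<subseteq> L"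
    unfolding alt_group_carrier_as_three_cycles by (rule S.generate_subgroup_incl[OF _ L])
  then show ?thesis using L.subset by auto
qed

lemma conj_rot_moves:
  assumes "y \<in> carrier (alt_group m)"
  shows "(y \<circ> h 1 \<circ> inv' y) z \<noteq> z \<longleftrightarrow> z \<in> y ` A"
proof -
  have b: "bij y" using alt_bij assms .
  have "(y \<circ> h 1 \<circ> inv' y) z \<noteq> z \<longleftrightarrow> h 1 (inv' y z) \<noteq> inv' y z"
    unfolding comp_apply using bij_inv_eq_iff[OF b, of "h 1 (inv' y z)" z] by blast
  also have "\<dots> \<longleftrightarrow> inv' y z \<in> A" by (rule h_moves)
  also have "\<dots> \<longleftrightarrow> z \<in> y ` A"
  proof
    assume "inv' y z \<in> A"
    then have "y (inv' y z) \<in> y ` A" by (rule imageI)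
    then show "z \<in> y ` A" using b by (simp add: bij_is_surj surj_f_inv_f)
  next
    assume "z \<in> y ` A"
    then show "inv' y z \<in> A" using b by (auto simp: bij_is_inj)
  qed
  finally show ?thesis .
qed

text \<open>The commutator of \<open>h 1\<close> with its conjugate by \<open>y\<close> is a 3-cycle
  in coordinate \<open>i\<close> and trivial in coordinate \<open>j\<close>. The values at
  \<open>i\<close> of the elements of \<open>K\<close> trivial at \<open>j\<close> thus form a
  subgroup containing a 3-cycle and stable under conjugation by \<open>h\<close> and
  \<open>w\<close>, so they are the whole alternating group.\<close>

lemma power_generates:
  assumes I: "finite I" "card I \<ge> 2"
    and K: "subgroup K (product_group I (\<lambda>_. alt_group m))"
    and hK: "\<And>s. (\<lambda>i\<in>I. h s) \<in> K" and wK: "\<And>u. (\<lambda>i\<in>I. w u) \<in> K"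
    and sep: "\<And>i j. i \<in> I \<Longrightarrow> j \<in> I \<Longrightarrow> i \<noteq> j \<Longrightarrow>
      \<exists>y\<in>K. card (y i ` A \<inter> A) = 1 \<and> y j ` A \<inter> A = {}"
  shows "K = carrier (product_group I (\<lambda>_. alt_group m))"
proof (rule subgroup_product_group_eq_carrier[OF alt_group_is_group _ I K])
  \<comment> \<open>Both cycle lengths are odd and at least 3, so the degree is in the range where
    the alternating group is perfect.\<close>
  have m5: "m \<ge> 5" using Q M by (auto simp: m_def elim!: oddE)
  show "derived (alt_group m) (carrier (alt_group m)) = carrier (alt_group m)"
    by (rule derived_alt_group_const[OF m5])
next
  fix i j s assume ij: "i \<in> I" "j \<in> I" "i \<noteq> j" and s: "s \<in> carrier (alt_group m)"
  let ?S = "alt_group m"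
  interpret S: group ?S by (rule alt_group_is_group)
  interpret K: subgroup K "product_group I (\<lambda>_. ?S)" by fact
  have Kc: "f i \<in> carrier ?S" if "f \<in> K" "i \<in> I" for f i
    using K.subset that by auto
  have Kinv: "(\<lambda>i\<in>I. inv' (f i)) \<in> K" if "f \<in> K" for f
  proof -
    have "inv\<^bsub>product_group I (\<lambda>_. ?S)\<^esub> f = (\<lambda>i\<in>I. inv' (f i))"
      using K.subset that
      by (subst inv_product_group) (auto simp: alt_group_inv_equality Kc[OF that] alt_group_is_group cong: restrict_cong)
    then show ?thesis using K.m_inv_closed[OF that] by simp
  qed
  have Kmult: "(\<lambda>i\<in>I. f i \<circ> g i) \<in> K" if "f \<in> K" "g \<in> K" for f g
    using K.m_closed[OF that] by (simp add: alt_group_mult)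
  define L where "L = {f i | f. f \<in> K \<and> f j = id}"
  have L: "subgroup L ?S"
  proof (rule S.subgroupI)
    show "L \<subseteq> carrier ?S" using Kc ij by (auto simp: L_def)
    have "(\<lambda>i\<in>I. h 0) i \<in> L" unfolding L_def
      using hK[of 0] ij by (intro CollectI exI[of _ "\<lambda>i\<in>I. h 0"]) auto
    then show "L \<noteq> {}" by auto
    show "inv\<^bsub>?S\<^esub> a \<in> L" if "a \<in> L" for a
    proof -
      from that obtain f where f: "f \<in> K" "f j = id" "a = f i" by (auto simp: L_def)
      then show ?thesis unfolding L_def
        using Kinv[OF f(1)] ij Kc[OF f(1) ij(1)]
        by (intro CollectI exI[of _ "\<lambda>i\<in>I. inv' (f i)"]) (auto simp: alt_group_inv_equality)
    qed
    show "a \<otimes>\<^bsub>?S\<^esub> b \<in> L" if "a \<in> L" "b \<in> L" for a b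
    proof -
      from that obtain f g where f: "f \<in> K" "f j = id" "a = f i"
        and g: "g \<in> K" "g j = id" "b = g i" by (auto simp: L_def)
      then show ?thesis unfolding L_def
        using Kmult[OF f(1) g(1)] ij
        by (intro CollectI exI[of _ "\<lambda>i\<in>I. f i \<circ> g i"]) (auto simp: alt_group_mult)
    qed
  qed
  have conj: "q \<circ> p \<circ> inv' q \<in> L" if p: "p \<in> L" and q: "(\<lambda>i\<in>I. q) \<in> K" for p q
  proof -
    from p obtain f where f: "f \<in> K" "f j = id" "p = f i" by (auto simp: L_def)
    have bq: "bij q" using alt_bij Kc[OF q ij(1)] ij by simp
    have "(\<lambda>i\<in>I. q \<circ> f i \<circ> inv' q) \<in> K"
      using Kmult[OF Kmult[OF q f(1)] Kinv[OF q]] by (simp cong: restrict_cong)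
    moreover have "q \<circ> inv' q = id" using bq by (metis bij_is_surj surj_iff)
    ultimately show ?thesis unfolding L_def using ij f
      by (intro CollectI exI[of _ "\<lambda>i\<in>I. q \<circ> f i \<circ> inv' q"]) auto
  qed
  obtain y where y: "y \<in> K" "card (y i ` A \<inter> A) = 1" "y j ` A \<inter> A = {}" using sep[OF ij] by blast
  have yc: "y i \<in> carrier ?S" "y j \<in> carrier ?S" using Kc y ij by auto
  obtain a where a: "y i ` A \<inter> A = {a}" using y(2) by (auto simp: card_1_singleton_iff)
  \<comment> \<open>In coordinate \<open>l\<close>, the conjugate of \<open>h 1\<close> by
    \<open>y l\<close> has as support the image of \<open>A\<close> under
    \<open>y l\<close>.\<close>
  define q where "q = (\<lambda>i\<in>I. y i \<circ> h 1 \<circ> inv' (y i))"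
  have qK: "q \<in> K"
    using Kmult[OF Kmult[OF y(1) hK[of 1]] Kinv[OF y(1)]] by (simp add: q_def cong: restrict_cong)
  define f where "f = (\<lambda>i\<in>I. h 1 \<circ> q i \<circ> inv' (h 1) \<circ> inv' (q i))"
  have fK: "f \<in> K"
    using Kmult[OF Kmult[OF Kmult[OF hK[of 1] qK] Kinv[OF hK[of 1]]] Kinv[OF qK]]
    by (simp add: f_def cong: restrict_cong)
  have qb: "bij (q i)" "bij (q j)" using alt_bij Kc[OF qK] ij by auto
  have qi: "q i z \<noteq> z \<longleftrightarrow> z \<in> y i ` A" for z
    using conj_rot_moves[OF yc(1)] ij by (simp add: q_def)
  have qj: "q j z \<noteq> z \<longleftrightarrow> z \<in> y j ` A" for z
    using conj_rot_moves[OF yc(2)] ij by (simp add: q_def)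
  have "f j = id"
    unfolding f_def using ij qj y(3) h_moves
    by (simp only: restrict_apply if_True) (intro commutator_disjoint bij_rot qb, blast)
  moreover have fi: "f i = cycle_of_list [a, h 1 a, q i a]"
    unfolding f_def using ij qi a h_moves
    by (simp only: restrict_apply if_True) (intro commutator_three_cycle bij_rot qb, blast+)
  ultimately have "f i \<in> L" unfolding L_def using fK by blast
  then have cL: "cycle_of_list [a, h 1 a, q i a] \<in> L" by (simp only: fi)
  have aA: "a \<in> A" "a \<in> y i ` A" using a by auto
  \<comment> \<open>The point \<open>q i a\<close> stays in the support of \<open>q i\<close> but
    differs from \<open>a\<close>, the only common point with \<open>A\<close>; so it lies in
    \<open>Z\<close>, as \<open>alt_group_eqI\<close> requires.\<close>
  have "q i (q i a) \<noteq> q i a" using qi[of a] aA qb by (metis bij_is_inj injD)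
  then have "q i a \<in> y i ` A" using qi by blast
  moreover have "q i a \<noteq> a" using qi aA by blast
  ultimately have "q i a \<notin> A" using a by blast
  moreover have "q i a \<in> {1..m}"
    using alt_perm[OF Kc[OF qK ij(1)]] aA(1) AZ(2) by (metis Un_iff permutes_in_image)
  ultimately have "q i a \<in> Z" using AZ(2) by blast
  moreover have "h 1 a \<noteq> a" using h_moves aA by blast
  moreover have "h 1 a \<in> A" using rot_in[of a 1 Q 1] aA by (simp add: A_def)
  ultimately have "L = carrier ?S"
    using conj hK wK cL aA(1) by (intro alt_group_eqI[OF L, of a "h 1 a" "q i a"]) auto
  with s have "s \<in> L" by simp
  then show "\<exists>f\<in>K. f i = s \<and> f j = \<one>\<^bsub>?S\<^esub>" by (auto simp: L_def alt_group_one)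
qed

end

section \<open>Counting permutations\<close>

text \<open>Take a maximal independent set or its complement, whichever is smaller.\<close>

lemma dominating_set:
  fixes E :: "'a \<Rightarrow> 'a \<Rightarrow> bool"
  assumes V: "finite V" and sym: "\<And>u v. E u v \<Longrightarrow> E v u"
    and nbr: "\<And>v. v \<in> V \<Longrightarrow> v \<notin> B \<Longrightarrow> \<exists>v'\<in>V. v' \<noteq> v \<and> E v v'"
  obtains T where "T \<subseteq> V" "2 * card T \<le> card V" "\<And>v. v \<in> V - T \<Longrightarrow> v \<in> B \<or> (\<exists>t\<in>T. E t v)"
proof -
  define indep where "indep U \<longleftrightarrow> U \<subseteq> V \<and> (\<forall>u\<in>U. \<forall>v\<in>U. u \<noteq> v \<longrightarrow> \<not> E u v)" for U
  have "finite {U. indep U}" by (rule finite_subset[of _ "Pow V"]) (use V in \<open>auto simp: indep_def\<close>)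
  moreover have "{} \<in> {U. indep U}" by (simp add: indep_def)
  ultimately obtain U where U: "indep U" and max: "\<And>U'. indep U' \<Longrightarrow> U \<subseteq> U' \<Longrightarrow> U = U'"
    using finite_has_maximal[of "{U. indep U}"] by blast
  have UV: "U \<subseteq> V" using U by (simp add: indep_def)
  have 1: "\<exists>t\<in>U. E t v" if v: "v \<in> V - U" for v
  proof (rule ccontr)
    assume "\<not> (\<exists>t\<in>U. E t v)"
    then have "indep (insert v U)" using U v sym by (auto simp: indep_def)
    then show False using max[of "insert v U"] v by auto
  qed
  \<comment> \<open>Outside \<open>B\<close>, a point of \<open>U\<close> has a neighbour, and
    independence of \<open>U\<close> places that neighbour in the complement.\<close>
  have 2: "v \<in> B \<or> (\<exists>t\<in>V - U. E t v)" if v: "v \<in> V - (V - U)" for v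
  proof (cases "v \<in> B")
    case False
    then obtain v' where v': "v' \<in> V" "v' \<noteq> v" "E v v'" using nbr v by blast
    then have "v' \<notin> U" using U v by (auto simp: indep_def)
    then show ?thesis using v' sym by blast
  qed simp
  have "card U + card (V - U) = card V"
    using UV V by (metis card_Diff_subset card_mono finite_subset le_add_diff_inverse)
  then consider "2 * card U \<le> card V" | "2 * card (V - U) \<le> card V" by linarith
  then show thesis
  proof cases
    case 1
    show thesis by (rule that[OF UV 1]) (use \<open>\<And>v. v \<in> V - U \<Longrightarrow> \<exists>t\<in>U. E t v\<close> in blast)
  next
    case 2
    show thesis by (rule that[of "V - U"]) (use 2 \<open>\<And>v. v \<in> V - (V - U) \<Longrightarrow> v \<in> B \<or> (\<exists>t\<in>V - U. E t v)\<close> in auto)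
  qed
qed

text \<open>Composition with the inverse of one solution \<open>x0\<close> embeds the set into the
  pointwise stabilizer of \<open>D\<close>.\<close>

lemma card_permutes_fixed_on:
  assumes "finite X" "D \<subseteq> X"
  shows "card {x. x permutes X \<and> (\<forall>d\<in>D. x d = \<phi> d)} \<le> fact (card X - card D)"
proof (cases "{x. x permutes X \<and> (\<forall>d\<in>D. x d = \<phi> d)} = {}")
  case False
  then obtain x0 where x0: "x0 permutes X" "\<forall>d\<in>D. x0 d = \<phi> d" by blast
  have "card {x. x permutes X \<and> (\<forall>d\<in>D. x d = \<phi> d)} \<le> card {p. p permutes X - D}"
  proof (rule card_inj_on_le)
    show "inj_on (\<lambda>x. inv' x0 \<circ> x) {x. x permutes X \<and> (\<forall>d\<in>D. x d = \<phi> d)}"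
      by (rule inj_onI) (metis fun.map_comp id_comp permutes_inv_o(1)[OF x0(1)])
    show "(\<lambda>x. inv' x0 \<circ> x) ` {x. x permutes X \<and> (\<forall>d\<in>D. x d = \<phi> d)} \<subseteq> {p. p permutes X - D}"
    proof safe
      fix x assume x: "x permutes X" "\<forall>d\<in>D. x d = \<phi> d"
      show "inv' x0 \<circ> x permutes X - D"
      proof (rule permutes_superset)
        show "inv' x0 \<circ> x permutes X" by (rule permutes_compose[OF x(1) permutes_inv[OF x0(1)]])
        show "(inv' x0 \<circ> x) d = d" if "d \<in> X - (X - D)" for d
        proof -
          have "x d = x0 d" using that x x0 by auto
          then show ?thesis using permutes_inverses(2)[OF x0(1)] by simp
        qed
      qed
    qed
    show "finite {p. p permutes X - D}" using assms by (intro finite_permutations) auto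
  qed
  also have "\<dots> = fact (card X - card D)"
    using assms by (simp add: card_permutations card_Diff_subset finite_subset)
  finally show ?thesis .
next
  case True
  show ?thesis by (simp only: True card.empty le0)
qed

text \<open>Each of the \<open>t\<close> largest factors of \<open>fact n\<close> is at least
  \<open>n / 2\<close>. Prescribing \<open>t\<close> values of a random permutation therefore costs
  a factor \<open>n ^ t\<close>, up to a constant independent of \<open>n\<close>.\<close>

lemma fact_mult_power_le:
  assumes "2 * t \<le> n"
  shows "fact (n - t) * n ^ t \<le> 2 ^ t * (fact n :: nat)"
  using assms
proof (induction t)
  case (Suc t)
  have "n - t = Suc (n - Suc t)" using Suc.prems by auto
  then have f: "fact (n - t) = (n - t) * (fact (n - Suc t) :: nat)" by simp
  have "fact (n - Suc t) * n ^ Suc t \<le> fact (n - Suc t) * (2 * (n - t)) * n ^ t"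
    using Suc.prems by (simp add: mult_le_mono)
  also have "\<dots> = 2 * (fact (n - t) * n ^ t)" by (simp add: f)
  also have "\<dots> \<le> 2 * (2 ^ t * fact n)" using Suc by (intro mult_left_mono) auto
  finally show ?case by simp
qed simp

lemma card_UN_le_mult:
  assumes "finite I" "card I \<le> a" "\<And>i. i \<in> I \<Longrightarrow> card (F i) \<le> b"
  shows "card (\<Union>i\<in>I. F i) \<le> a * b"
proof -
  have "card (\<Union>i\<in>I. F i) \<le> (\<Sum>i\<in>I. card (F i))" by (rule card_UN_le[OF assms(1)])
  also have "\<dots> \<le> card I * b" using sum_bounded_above[of I "\<lambda>i. card (F i)" b] assms by simp
  also have "\<dots> \<le> a * b" using assms by simp
  finally show ?thesis .
qed

lemma card_le_1_if_unique:
  assumes "\<And>x y. x \<in> X \<Longrightarrow> y \<in> X \<Longrightarrow> x = y"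
  shows "card X \<le> Suc 0 \<and> finite X"
proof (cases "X = {}")
  case False
  then obtain x where "X = {x}" using assms by blast
  then show ?thesis by simp
qed simp

section \<open>How the shifts of the image of \<open>A\<close> meet the preimage of
  \<open>A\<close>\<close>

context rotations
begin

definition preim :: "(nat \<Rightarrow> nat) \<Rightarrow> nat set" where "preim x = {z. x z \<in> A}"

text \<open>With \<open>y = x h\<^sup>s w\<^sup>u x\<close>, the two conditions say that \<open>y(A)\<close> meets \<open>A\<close> in one point, and that the
  corresponding word in \<open>x'\<close> moves \<open>A\<close> off itself.\<close>

definition separated :: "(nat \<Rightarrow> nat) \<Rightarrow> (nat \<Rightarrow> nat) \<Rightarrow> bool" where
  "separated x x' \<longleftrightarrow> (\<exists>s u. card ((h s \<circ> w u) ` x ` A \<inter> preim x) = 1 \<and>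
     (h s \<circ> w u) ` x' ` A \<inter> preim x' = {})"

text \<open>Used with \<open>B\<close> the image of \<open>A\<close> under \<open>x\<close>: one
  shift takes \<open>b\<close> and another point \<open>b'\<close> of \<open>B\<close> to
  \<open>t\<close> and \<open>v\<close>, in either order. Allowing both orders makes the relation
  between \<open>t\<close> and \<open>v\<close> symmetric, as \<open>dominating_set\<close>
  demands.\<close>

definition nbrs :: "nat set \<Rightarrow> nat \<Rightarrow> nat \<Rightarrow> nat set" where
  "nbrs B b t = {v. \<exists>u. \<exists>b'\<in>B \<inter> Z. w u b = t \<and> w u b' = v \<or> w u b = v \<and> w u b' = t}"

text \<open>Used with \<open>C\<close> the image of \<open>A\<close> under \<open>x'\<close> and
  \<open>V = preim x'\<close>: these are the targets \<open>v\<close> that must be avoided, since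
  the shift taking \<open>b\<close> to \<open>v\<close> spoils the empty intersection wanted for
  \<open>x'\<close>.\<close>

definition hits :: "nat set \<Rightarrow> nat set \<Rightarrow> nat \<Rightarrow> nat set" where
  "hits C V b = {v. \<exists>u. w u b = v \<and> w u ` (C \<inter> Z) \<inter> V \<noteq> {}}"

lemma w_unique: "z \<in> Z \<Longrightarrow> w s z = w t z \<Longrightarrow> w s = w t"
  using rot_free[of z "Suc Q" M s t] rot_mod[of "Suc Q" M] by (metis Z_def)

lemma h_unique: "z \<in> A \<Longrightarrow> s < Q \<Longrightarrow> t < Q \<Longrightarrow> h s z = h t z \<Longrightarrow> s = t"
  using rot_free[of z 1 Q s t] by (auto simp: A_def)

lemma hw_A: "x \<in> A \<Longrightarrow> (h s \<circ> w u) x = h s x \<and> h s x \<in> A"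
  using rot_in[of x 1 Q s] rot_fixes[of x "Suc Q" M u] by (auto simp: A_def)

lemma hw_Z: "x \<in> Z \<Longrightarrow> (h s \<circ> w u) x = w u x \<and> w u x \<in> Z"
  using rot_in[of x "Suc Q" M u] rot_fixes[of "w u x" 1 Q s] by (auto simp: Z_def)

text \<open>A shift is determined by what it does to one point of \<open>Z\<close>, so each pair in
  \<open>C \<times> V\<close> accounts for at most one \<open>v\<close>.\<close>

lemma card_hits:
  assumes "b \<in> Z" "finite C" "card C \<le> Q" "finite V" "card V \<le> Q"
  shows "card (hits C V b) \<le> Q\<^sup>2 \<and> finite (hits C V b)"
proof -
  let ?F = "\<lambda>(c, c'). {v. \<exists>u. w u b = v \<and> w u c = c'}"
  have u: "card (?F p) \<le> 1 \<and> finite (?F p)" if pin: "p \<in> (C \<inter> Z) \<times> V" for p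
  proof -
    obtain c c' where p: "p = (c, c')" "c \<in> Z" using pin by auto
    show ?thesis unfolding p by (simp, rule card_le_1_if_unique) (use p w_unique in \<open>clarsimp, metis\<close>)
  qed
  have sub: "hits C V b \<subseteq> (\<Union>p\<in>(C \<inter> Z) \<times> V. ?F p)" by (auto simp: hits_def)
  have fin: "finite ((C \<inter> Z) \<times> V)" using assms by auto
  have finU: "finite (\<Union>p\<in>(C \<inter> Z) \<times> V. ?F p)" using u fin by blast
  have "card ((C \<inter> Z) \<times> V) \<le> Q * Q"
    unfolding card_cartesian_product using assms card_mono[of C "C \<inter> Z"] by (intro mult_le_mono) auto
  from card_UN_le_mult[OF fin this, of ?F 1] u have "card (\<Union>p\<in>(C \<inter> Z) \<times> V. ?F p) \<le> Q * Q" by auto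
  then have "card (hits C V b) \<le> Q * Q" using card_mono[OF finU sub] by linarith
  then show ?thesis using finite_subset[OF sub finU] by (simp add: power2_eq_square)
qed

text \<open>Each \<open>b'\<close> accounts for at most one \<open>v\<close> in each of the two
  orders.\<close>

lemma card_nbrs:
  assumes "b \<in> Z" "finite B" "card B \<le> Q"
  shows "card (nbrs B b t) \<le> 2 * Q \<and> finite (nbrs B b t)"
proof -
  let ?F = "\<lambda>b'. {v. \<exists>u. w u b = t \<and> w u b' = v} \<union> {v. \<exists>u. w u b = v \<and> w u b' = t}"
  have u: "card (?F b') \<le> 2 \<and> finite (?F b')" if "b' \<in> B \<inter> Z" for b'
  proof -
    have 1: "card {v. \<exists>u. w u b = t \<and> w u b' = v} \<le> Suc 0 \<and> finite {v. \<exists>u. w u b = t \<and> w u b' = v}"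
      by (rule card_le_1_if_unique) (use assms(1) w_unique in \<open>clarsimp, metis\<close>)
    have 2: "card {v. \<exists>u. w u b = v \<and> w u b' = t} \<le> Suc 0 \<and> finite {v. \<exists>u. w u b = v \<and> w u b' = t}"
      by (rule card_le_1_if_unique) (use that w_unique in \<open>clarsimp, metis\<close>)
    show ?thesis using 1 2 card_Un_le[of "{v. \<exists>u. w u b = t \<and> w u b' = v}" "{v. \<exists>u. w u b = v \<and> w u b' = t}"]
      by auto
  qed
  have sub: "nbrs B b t \<subseteq> (\<Union>b'\<in>B \<inter> Z. ?F b')" by (auto simp: nbrs_def)
  have fin: "finite (B \<inter> Z)" using assms by auto
  have finU: "finite (\<Union>b'\<in>B \<inter> Z. ?F b')" using u fin by blast
  have "card (B \<inter> Z) \<le> Q" using assms card_mono[of B "B \<inter> Z"] by auto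
  from card_UN_le_mult[OF fin this, of ?F 2] u have "card (\<Union>b'\<in>B \<inter> Z. ?F b') \<le> Q * 2" by auto
  then have "card (nbrs B b t) \<le> 2 * Q" using card_mono[OF finU sub] by linarith
  then show ?thesis using finite_subset[OF sub finU] by simp
qed

lemma perm_image_A: "x \<in> carrier (alt_group m) \<Longrightarrow> x ` A \<subseteq> {1..m} \<and> card (x ` A) = Q \<and> finite (x ` A)"
  using AZ alt_perm[of x] permutes_image[of x "{1..m}"]
  by (auto simp: card_image permutes_inj_on simp del: permutes_image)

lemma preim_sub: "x \<in> carrier (alt_group m) \<Longrightarrow> preim x \<subseteq> {1..m} \<and> x ` preim x = A"
proof -
  assume x: "x \<in> carrier (alt_group m)"
  have p: "x permutes {1..m}" using alt_perm[OF x] .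
  have "preim x \<subseteq> {1..m}"
  proof
    fix z assume "z \<in> preim x"
    then have "x z \<in> {1..m}" using AZ(2) by (auto simp: preim_def)
    then show "z \<in> {1..m}" using permutes_in_image[OF p] by blast
  qed
  moreover have "x ` preim x = A"
  proof -
    have "a \<in> x ` preim x" if "a \<in> A" for a
      using that permutes_surj[OF p] by (metis (mono_tags, lifting) image_iff mem_Collect_eq preim_def surjD)
    then show ?thesis by (auto simp: preim_def)
  qed
  ultimately show ?thesis ..
qed

lemma card_preim: "x \<in> carrier (alt_group m) \<Longrightarrow> card (preim x) = Q \<and> finite (preim x)"
  using preim_sub[of x] alt_bij[of x] AZ(5) card_image[of x "preim x"]
  by (metis bij_is_inj finite_atLeastAtMost finite_subset inj_on_subset subset_UNIV)

lemma card_preim_A: "x \<in> carrier (alt_group m) \<Longrightarrow> card (preim x \<inter> A) = card (x ` A \<inter> A)"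
proof -
  assume x: "x \<in> carrier (alt_group m)"
  have "x ` (preim x \<inter> A) = x ` A \<inter> A" by (auto simp: preim_def)
  then show ?thesis using alt_bij[OF x] by (metis bij_is_inj card_image inj_on_subset subset_UNIV)
qed

text \<open>A bad shift takes a point of the image of \<open>A\<close> inside \<open>A\<close> to a
  point of \<open>preim x \<inter> A\<close>. There are at most \<open>(r - 1)\<^sup>2\<close> such
  pairs, and each determines \<open>s\<close>.\<close>

lemma card_bad_shifts:
  assumes x: "x \<in> carrier (alt_group m)" and r: "card (x ` A \<inter> A) < r"
  shows "card {s. s < Q \<and> h s ` (x ` A \<inter> A) \<inter> preim x \<noteq> {}} \<le> (r - 1)\<^sup>2"
proof -
  let ?F = "\<lambda>(c, c'). {s. s < Q \<and> h s c = c'}"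
  let ?P = "(x ` A \<inter> A) \<times> (preim x \<inter> A)"
  have u: "card (?F p) \<le> 1 \<and> finite (?F p)" if pin: "p \<in> ?P" for p
  proof -
    obtain c c' where p: "p = (c, c')" "c \<in> A" using pin by auto
    have "card {s. s < Q \<and> h s c = c'} \<le> Suc 0 \<and> finite {s. s < Q \<and> h s c = c'}"
      by (rule card_le_1_if_unique) (use p h_unique in auto)
    then show ?thesis by (simp add: p)
  qed
  have fin: "finite ?P" using AZ(3) by auto
  have "card ?P \<le> (r - 1) * (r - 1)"
    unfolding card_cartesian_product card_preim_A[OF x] using r by (intro mult_le_mono) auto
  from card_UN_le_mult[OF fin this, of ?F 1] u
  have le: "card (\<Union>p\<in>?P. ?F p) \<le> (r - 1)\<^sup>2" by (auto simp: power2_eq_square)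
  have "{s. s < Q \<and> h s ` (x ` A \<inter> A) \<inter> preim x \<noteq> {}} \<subseteq> (\<Union>p\<in>?P. ?F p)"
  proof
    fix s assume "s \<in> {s. s < Q \<and> h s ` (x ` A \<inter> A) \<inter> preim x \<noteq> {}}"
    then obtain z where z: "s < Q" "z \<in> x ` A \<inter> A" "h s z \<in> preim x" by blast
    then have "(z, h s z) \<in> ?P" using hw_A[of z s] by blast
    then show "s \<in> (\<Union>p\<in>?P. ?F p)" using z(1) by (intro UN_I[of "(z, h s z)"]) auto
  qed
  moreover have "finite (\<Union>p\<in>?P. ?F p)" using u fin by blast
  ultimately have "card {s. s < Q \<and> h s ` (x ` A \<inter> A) \<inter> preim x \<noteq> {}} \<le> card (\<Union>p\<in>?P. ?F p)"
    by (intro card_mono)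
  with le show ?thesis by linarith
qed

text \<open>Both shifts preserve \<open>A\<close> and \<open>Z\<close>, and \<open>w\<close> fixes
  \<open>A\<close> pointwise. Once \<open>h s\<close> has emptied the intersection inside
  \<open>A\<close>, only the part in \<open>Z\<close> is left and it depends on \<open>u\<close>
  alone.\<close>

lemma hw_image_inter:
  assumes x: "x \<in> carrier (alt_group m)" and s: "h s ` (x ` A \<inter> A) \<inter> preim x = {}"
  shows "(h s \<circ> w u) ` x ` A \<inter> preim x = w u ` (x ` A \<inter> Z) \<inter> (preim x \<inter> Z)"
proof -
  have "x ` A = (x ` A \<inter> A) \<union> (x ` A \<inter> Z)" using perm_image_A[OF x] AZ(2) by blast
  then have "(h s \<circ> w u) ` x ` A = (h s \<circ> w u) ` (x ` A \<inter> A) \<union> (h s \<circ> w u) ` (x ` A \<inter> Z)"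
    by (metis image_Un)
  also have "(h s \<circ> w u) ` (x ` A \<inter> A) = h s ` (x ` A \<inter> A)"
    using hw_A by (intro image_cong) auto
  also have "(h s \<circ> w u) ` (x ` A \<inter> Z) = w u ` (x ` A \<inter> Z)"
    using hw_Z by (intro image_cong) auto
  finally have "(h s \<circ> w u) ` x ` A = h s ` (x ` A \<inter> A) \<union> w u ` (x ` A \<inter> Z)" .
  moreover have "w u ` (x ` A \<inter> Z) \<subseteq> Z" using hw_Z by blast
  ultimately show ?thesis using s by blast
qed

text \<open>The shift by \<open>h\<^sup>s\<close> is chosen first, so that nothing happens inside \<open>A\<close>; the shifts by \<open>w\<^sup>u\<close> that
  take \<open>b\<close> to a point of \<open>preim x\<close> are then the candidates.\<close>

lemma not_separated_dominated:
  assumes x: "x \<in> carrier (alt_group m)" "card (x ` A \<inter> A) < r"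
    and x': "x' \<in> carrier (alt_group m)" "card (x' ` A \<inter> A) < r"
    and r: "2 * (r - 1)\<^sup>2 < Q" "r \<le> Q" and nsep: "\<not> separated x x'" and b: "b \<in> x ` A \<inter> Z"
  obtains T where "T \<subseteq> Z" "2 * card T \<le> Q"
    "preim x \<inter> Z \<subseteq> T \<union> hits (x' ` A) (preim x') b \<union> (\<Union>t\<in>T. nbrs (x ` A) b t)"
proof -
  let ?S = "\<lambda>x. {s. s < Q \<and> h s ` (x ` A \<inter> A) \<inter> preim x \<noteq> {}}"
  \<comment> \<open>Together \<open>x\<close> and \<open>x'\<close> exclude at most
    \<open>2 * (r - 1)\<^sup>2 < Q\<close> values, so some \<open>s\<close> is good for
    both.\<close>
  have "card (?S x \<union> ?S x') < card {..<Q}"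
    using card_bad_shifts[OF x] card_bad_shifts[OF x'] card_Un_le[of "?S x" "?S x'"] r by simp
  then have "\<not> {..<Q} \<subseteq> ?S x \<union> ?S x'"
    using card_mono[of "?S x \<union> ?S x'" "{..<Q}"] by auto
  then obtain s where s: "h s ` (x ` A \<inter> A) \<inter> preim x = {}" "h s ` (x' ` A \<inter> A) \<inter> preim x' = {}" by blast
  note int = hw_image_inter[OF x(1) s(1)] hw_image_inter[OF x'(1) s(2)]
  define V where "V = preim x \<inter> Z"
  define E where "E t v \<longleftrightarrow> v \<in> nbrs (x ` A) b t" for t v
  have finV: "finite V" using AZ by (simp add: V_def)
  have sym: "E v u" if "E u v" for u v using that by (auto simp: E_def nbrs_def)
  \<comment> \<open>If \<open>v\<close> is not a hit, the shift taking \<open>b\<close> to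
    \<open>v\<close> satisfies the condition on \<open>x'\<close>. Failure of
    \<open>separated\<close> then means that the intersection for \<open>x\<close>, which contains
    \<open>v\<close>, has a second point, and that point is a neighbour of \<open>v\<close>.\<close>
  have nbr: "\<exists>v'\<in>V. v' \<noteq> v \<and> E v v'" if v: "v \<in> V" "v \<notin> hits (x' ` A) (preim x') b" for v
  proof -
    obtain u where u: "w u b = v"
      using rot_transitive[of b "Suc Q" M v] b v(1) by (auto simp: V_def Z_def)
    have "w u ` (x' ` A \<inter> Z) \<inter> preim x' = {}" using v(2) u by (auto simp: hits_def)
    then have "(h s \<circ> w u) ` x' ` A \<inter> preim x' = {}" unfolding int(2) by blast
    then have "card ((h s \<circ> w u) ` x ` A \<inter> preim x) \<noteq> 1"
      using nsep unfolding separated_def by blast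
    then have c: "card (w u ` (x ` A \<inter> Z) \<inter> V) \<noteq> 1" unfolding int(1) V_def .
    have vin: "v \<in> w u ` (x ` A \<inter> Z) \<inter> V" using u b v by blast
    obtain v' where v': "v' \<in> w u ` (x ` A \<inter> Z) \<inter> V" "v' \<noteq> v"
    proof (rule ccontr)
      assume "\<not> thesis"
      then have "w u ` (x ` A \<inter> Z) \<inter> V = {v}" using vin that by blast
      then show False using c by simp
    qed
    then have "E v v'" using u unfolding E_def nbrs_def by blast
    then show ?thesis using v' by blast
  qed
  obtain T where T: "T \<subseteq> V" "2 * card T \<le> card V"
      "\<And>v. v \<in> V - T \<Longrightarrow> v \<in> hits (x' ` A) (preim x') b \<or> (\<exists>t\<in>T. E t v)"
    using dominating_set[OF finV sym nbr] by blast
  have "card V \<le> Q" using card_preim[OF x(1)] card_mono[of "preim x" V] by (simp add: V_def)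
  then show thesis using T by (intro that[of T]) (auto simp: V_def E_def)
qed

end

text \<open>The implied constant in the union bound for a pair of coordinates.\<close>

definition badness :: "nat \<Rightarrow> nat \<Rightarrow> nat" where
  "badness Q r = 2 * (2 ^ (Q + r + 1) * Q ^ r) + (4 * Q\<^sup>2) ^ Q * 2 ^ (2 * Q + 1)"

section \<open>Upper bounds for the number of bad permutations and bad pairs\<close>

context rotations
begin

lemma finite_alt: "finite (carrier (alt_group m))"
  by (rule finite_subset[OF _ finite_permutations[of "{1..m}"]]) (auto simp: alt_group_carrier)

lemma fact_m: "fact m = 2 * card (carrier (alt_group m))"
  using alt_group_card_carrier[of m] Q M by (simp add: m_def)

text \<open>Such an \<open>x\<close> maps some \<open>r\<close>-subset \<open>R\<close> of
  \<open>A\<close> into \<open>A\<close>. There are at most \<open>2 ^ Q\<close> choices for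
  \<open>R\<close>, \<open>Q ^ r\<close> for the values on it, and \<open>fact (m - r)\<close> for
  the rest.\<close>

lemma card_overlap:
  assumes r: "2 * r \<le> m"
  shows "card {x \<in> carrier (alt_group m). r \<le> card (x ` A \<inter> A)} * m ^ r
    \<le> 2 ^ (Q + r + 1) * Q ^ r * card (carrier (alt_group m))"
proof -
  let ?X = "{x \<in> carrier (alt_group m). r \<le> card (x ` A \<inter> A)}"
  let ?P = "\<lambda>R f. {x. x permutes {1..m} \<and> (\<forall>d\<in>R. x d = f d)}"
  let ?R = "{R. R \<subseteq> A \<and> card R = r}"
  let ?F = "\<lambda>R. \<Union>f\<in>R \<rightarrow>\<^sub>E A. ?P R f"
  have finP: "finite {x. x permutes {1..m}}" by (rule finite_permutations) simp
  have finR: "finite ?R" by (rule finite_subset[of _ "Pow A"]) (use AZ in auto)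
  have cR: "card ?R \<le> 2 ^ Q"
    using card_mono[of "Pow A" ?R] AZ by (auto simp: card_Pow)
  have cF: "card (?F R) \<le> Q ^ r * fact (m - r)" if R: "R \<in> ?R" for R
  proof (rule card_UN_le_mult)
    have finR': "finite R" using R AZ finite_subset by blast
    then show "finite (R \<rightarrow>\<^sub>E A)" using AZ by (intro finite_PiE) auto
    show "card (R \<rightarrow>\<^sub>E A) \<le> Q ^ r" using finR' R AZ by (simp add: card_PiE)
    fix f
    show "card (?P R f) \<le> fact (m - r)"
      using card_permutes_fixed_on[of "{1..m}" R f] R AZ by auto
  qed
  have "?X \<subseteq> (\<Union>R\<in>?R. ?F R)"
  proof
    fix x assume x: "x \<in> ?X"
    then have "r \<le> card (preim x \<inter> A)" using card_preim_A[of x] by simp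
    then obtain R where R: "R \<subseteq> preim x \<inter> A" "card R = r" by (meson obtain_subset_with_card_n)
    then have "restrict x R \<in> R \<rightarrow>\<^sub>E A" by (auto simp: preim_def)
    moreover have "x \<in> ?P R (restrict x R)" using alt_perm x by simp
    ultimately show "x \<in> (\<Union>R\<in>?R. ?F R)" using R by blast
  qed
  moreover have "finite (\<Union>R\<in>?R. ?F R)" by (rule finite_subset[OF _ finP]) auto
  ultimately have "card ?X \<le> card (\<Union>R\<in>?R. ?F R)" by (intro card_mono)
  also have "\<dots> \<le> 2 ^ Q * (Q ^ r * fact (m - r))"
    by (rule card_UN_le_mult[OF finR cR cF])
  finally have "card ?X * m ^ r \<le> 2 ^ Q * Q ^ r * (fact (m - r) * m ^ r)"
    by (simp add: mult.assoc mult_le_mono1 flip: mult.assoc)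
  also have "\<dots> \<le> 2 ^ Q * Q ^ r * (2 ^ r * fact m)"
    by (intro mult_left_mono fact_mult_power_le r) auto
  finally show ?thesis unfolding fact_m by (simp add: power_add algebra_simps)
qed

text \<open>A permutation \<open>x\<close> as below is determined, up to \<open>(m - t)!\<close> choices, by its restriction \<open>f\<close> to \<open>A\<close>, by
  the dominating set (encoded as \<open>T g\<close>), and by the inverse \<open>\<psi>\<close> of \<open>x\<close> on the rest of \<open>A\<close>, which takes
  its values in the bounded set \<open>W\<close>.\<close>

lemma card_not_separated:
  assumes x': "x' \<in> carrier (alt_group m)" "card (x' ` A \<inter> A) < r"
    and r: "2 * (r - 1)\<^sup>2 < Q" "4 * r \<le> Q" and m: "4 * Q \<le> m"
  shows "card {x \<in> carrier (alt_group m). card (x ` A \<inter> A) < r \<and> \<not> separated x x'} * m ^ r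
    \<le> (4 * Q\<^sup>2) ^ Q * 2 ^ (2 * Q + 1) * card (carrier (alt_group m))"
proof -
  let ?X = "{x \<in> carrier (alt_group m). card (x ` A \<inter> A) < r \<and> \<not> separated x x'}"
  define q where "q = Q div 2"
  \<comment> \<open>A lower bound for the number of points where \<open>x\<close> is prescribed:
    \<open>Q\<close> points of \<open>A\<close>, and the preimages of the more than
    \<open>Q - r\<close> points of \<open>A\<close> outside the image of \<open>A\<close>.\<close>
  define t where "t = 2 * Q - r"
  \<comment> \<open>The base point is a function of \<open>f\<close>, so choosing it adds nothing to
    the count.\<close>
  define base where "base f = (SOME b. b \<in> f ` A \<inter> Z)" for f :: "nat \<Rightarrow> nat"
  define W where "W f T = T \<union> hits (x' ` A) (preim x') (base f) \<union> (\<Union>t\<in>T. nbrs (f ` A) (base f) t)"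
    for f T
  define Fs where "Fs = {f \<in> A \<rightarrow>\<^sub>E {1..m}. f ` A \<inter> Z \<noteq> {}}"
  define Gs where "Gs = ({..<q} \<rightarrow>\<^sub>E {1..m})"
  \<comment> \<open>Intersecting with \<open>Z\<close> lets a tuple of exactly \<open>q\<close>
    entries encode a subset of \<open>Z\<close> with at most \<open>q\<close> elements.\<close>
  define T where "T g = g ` {..<q} \<inter> Z" for g :: "nat \<Rightarrow> nat"
  define Ps where "Ps f g = (A - f ` A \<rightarrow>\<^sub>E W f (T g))" for f g
  define F where "F f \<psi> = {x \<in> carrier (alt_group m). card (x ` A \<inter> A) < r \<and>
    (\<forall>a\<in>A. x a = f a) \<and> (\<forall>a\<in>A - f ` A. x (\<psi> a) = a)}" for f \<psi>
  have W: "card (W f (T g)) \<le> 4 * Q\<^sup>2 \<and> finite (W f (T g))" if f: "f \<in> Fs" for f g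
  proof -
    have "f ` A \<inter> Z \<noteq> {}" using f by (simp add: Fs_def)
    then have b: "base f \<in> Z" using someI_ex[of "\<lambda>b. b \<in> f ` A \<inter> Z"] unfolding base_def by blast
    have hits: "card (hits (x' ` A) (preim x') (base f)) \<le> Q\<^sup>2 \<and> finite (hits (x' ` A) (preim x') (base f))"
      using perm_image_A[OF x'(1)] card_preim[OF x'(1)] by (intro card_hits b) auto
    have fA: "finite (f ` A)" "card (f ` A) \<le> Q" using AZ card_image_le[of A f] by auto
    note nb = card_nbrs[OF b fA]
    have finT: "finite (T g)" by (simp add: T_def)
    have cT: "card (T g) \<le> q"
      using card_mono[of "g ` {..<q}" "T g"] card_image_le[of "{..<q}" g] by (auto simp: T_def)
    have cN: "card (\<Union>t\<in>T g. nbrs (f ` A) (base f) t) \<le> q * (2 * Q)"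
      by (rule card_UN_le_mult[OF finT cT]) (use nb in blast)
    have "card (W f (T g)) \<le> q + Q\<^sup>2 + q * (2 * Q)"
      unfolding W_def using cT hits cN
      by (meson add_mono card_Un_le le_trans)
    also have "\<dots> \<le> Q * Q + Q\<^sup>2 + Q * (2 * Q)"
    proof -
      have "q \<le> Q" by (simp add: q_def)
      moreover have "Q \<le> Q * Q" by simp
      ultimately show ?thesis by (intro add_mono mult_le_mono1; linarith)
    qed
    also have "\<dots> = 4 * Q\<^sup>2" by (simp add: power2_eq_square)
    finally have "card (W f (T g)) \<le> 4 * Q\<^sup>2" .
    moreover have "finite (W f (T g))" unfolding W_def using finT hits nb by blast
    ultimately show ?thesis ..
  qed
  have cF: "card (F f \<psi>) \<le> fact (m - t)" if f: "f \<in> Fs" for f \<psi>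
  proof (cases "F f \<psi> = {}")
    case False
    then obtain x0 where x0: "x0 \<in> carrier (alt_group m)" "card (x0 ` A \<inter> A) < r"
      "\<forall>a\<in>A. x0 a = f a" "\<forall>a\<in>A - f ` A. x0 (\<psi> a) = a" by (auto simp: F_def)
    have fA: "f ` A = x0 ` A" using x0(3) by simp
    define D where "D = A \<union> \<psi> ` (A - f ` A)"
    have inj: "inj_on \<psi> (A - f ` A)" using x0(4) by (metis inj_onI)
    \<comment> \<open>A point outside the image of \<open>A\<close> has its preimage outside
      \<open>A\<close>, so the two parts of \<open>D\<close> are disjoint and their sizes
      add.\<close>
    have "\<psi> a \<notin> A" if a: "a \<in> A - f ` A" for a
    proof
      assume \<psi>: "\<psi> a \<in> A"
      have "x0 (\<psi> a) = a" using x0(4) a by blast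
      then have "f (\<psi> a) = a" using x0(3) \<psi> by simp
      then have "a \<in> f ` A" using \<psi> by (intro image_eqI[of _ f "\<psi> a"]) simp_all
      then show False using a by blast
    qed
    then have "A \<inter> \<psi> ` (A - f ` A) = {}" by blast
    then have "card D = Q + card (A - f ` A)"
      unfolding D_def using AZ inj by (subst card_Un_disjoint) (auto simp: card_image)
    moreover have "card (A - f ` A) = Q - card (x0 ` A \<inter> A)"
      using card_Diff_subset_Int[of A "f ` A"] AZ by (simp add: fA Int_commute)
    ultimately have cD: "t \<le> card D" using x0(2) unfolding t_def by linarith
    have DS: "D \<subseteq> {1..m}"
    proof -
      have "\<psi> a \<in> {1..m}" if "a \<in> A - f ` A" for a
        using permutes_in_image[OF alt_perm[OF x0(1)], of "\<psi> a"] x0(4) that AZ(2) by auto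
      then show ?thesis using AZ(2) unfolding D_def by blast
    qed
    have "F f \<psi> \<subseteq> {x. x permutes {1..m} \<and> (\<forall>d\<in>D. x d = x0 d)}"
    proof
      fix x assume x: "x \<in> F f \<psi>"
      then have "\<forall>d\<in>D. x d = x0 d" using x0(3,4) by (auto simp: F_def D_def)
      moreover have "x permutes {1..m}" using x by (intro alt_perm) (simp add: F_def)
      ultimately show "x \<in> {x. x permutes {1..m} \<and> (\<forall>d\<in>D. x d = x0 d)}" by blast
    qed
    moreover have "finite {x. x permutes {1..m} \<and> (\<forall>d\<in>D. x d = x0 d)}"
      by (rule finite_subset[OF _ finite_permutations[of "{1..m}"]]) auto
    ultimately have "card (F f \<psi>) \<le> card {x. x permutes {1..m} \<and> (\<forall>d\<in>D. x d = x0 d)}"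
      by (intro card_mono)
    also have "\<dots> \<le> fact (card {1..m} - card D)"
      by (rule card_permutes_fixed_on) (use DS in auto)
    also have "\<dots> \<le> fact (m - t)" using cD by (intro fact_mono) auto
    finally show ?thesis .
  qed simp
  have cP: "card (\<Union>\<psi>\<in>Ps f g. F f \<psi>) \<le> (4 * Q\<^sup>2) ^ Q * fact (m - t)" if f: "f \<in> Fs" for f g
  proof (rule card_UN_le_mult[OF _ _ cF[OF f]])
    have finA: "finite (A - f ` A)" using AZ by simp
    show "finite (Ps f g)" unfolding Ps_def using W[OF f] finA by (intro finite_PiE) auto
    have "card (Ps f g) = card (W f (T g)) ^ card (A - f ` A)"
      unfolding Ps_def using finA by (simp add: card_PiE)
    also have "\<dots> \<le> (4 * Q\<^sup>2) ^ card (A - f ` A)" using W[OF f] by (intro power_mono) auto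
    also have "\<dots> \<le> (4 * Q\<^sup>2) ^ Q"
      using Q card_mono[of A "A - f ` A"] AZ by (intro power_increasing) (auto simp: Suc_le_eq)
    finally show "card (Ps f g) \<le> (4 * Q\<^sup>2) ^ Q" .
  qed
  have cG: "card (\<Union>g\<in>Gs. \<Union>\<psi>\<in>Ps f g. F f \<psi>) \<le> m ^ q * ((4 * Q\<^sup>2) ^ Q * fact (m - t))"
    if f: "f \<in> Fs" for f
    by (rule card_UN_le_mult[OF _ _ cP[OF f]]) (auto simp: Gs_def card_PiE intro: finite_PiE)
  have cFs: "card Fs \<le> m ^ Q" "finite Fs"
  proof -
    have fin: "finite (A \<rightarrow>\<^sub>E {1..m})" using AZ by (intro finite_PiE) auto
    have sub: "Fs \<subseteq> (A \<rightarrow>\<^sub>E {1..m})" by (auto simp: Fs_def)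
    show "finite Fs" using finite_subset[OF sub fin] .
    show "card Fs \<le> m ^ Q" using card_mono[OF fin sub] AZ by (simp add: card_PiE)
  qed
  have "?X \<subseteq> (\<Union>f\<in>Fs. \<Union>g\<in>Gs. \<Union>\<psi>\<in>Ps f g. F f \<psi>)"
  proof
    fix x assume "x \<in> ?X"
    then have x: "x \<in> carrier (alt_group m)" "card (x ` A \<inter> A) < r" "\<not> separated x x'" by auto
    note p = alt_perm[OF x(1)]
    define f where "f = restrict x A"
    have fA: "f ` A = x ` A" by (simp add: f_def)
    have "x ` A \<inter> Z \<noteq> {}"
    proof
      assume "x ` A \<inter> Z = {}"
      then have "x ` A \<inter> A = x ` A" using perm_image_A[OF x(1)] AZ(2) by blast
      then show False using x(2) perm_image_A[OF x(1)] r by simp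
    qed
    then have f: "f \<in> Fs" using perm_image_A[OF x(1)] by (auto simp: Fs_def f_def)
    have "\<exists>b. b \<in> f ` A \<inter> Z" unfolding fA using \<open>x ` A \<inter> Z \<noteq> {}\<close> by blast
    then have "base f \<in> f ` A \<inter> Z" unfolding base_def by (rule someI_ex)
    then have b: "base f \<in> x ` A \<inter> Z" unfolding fA .
    obtain U where U: "U \<subseteq> Z" "2 * card U \<le> Q"
      "preim x \<inter> Z \<subseteq> U \<union> hits (x' ` A) (preim x') (base f) \<union> (\<Union>t\<in>U. nbrs (x ` A) (base f) t)"
      using not_separated_dominated[OF x(1,2) x' r(1) _ x(3) b] r(2) by auto
    have finU: "finite U" using U(1) AZ(4) finite_subset by blast
    obtain e where e: "bij_betw e {0..<card U} U" using ex_bij_betw_nat_finite[OF finU] by blast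
    have cU: "card U \<le> q" using U(2) by (simp add: q_def)
    define g where "g = (\<lambda>i\<in>{..<q}. if i < card U then e i else 1)"
    have eU: "e i \<in> U" if "i < card U" for i using e that by (auto simp: bij_betw_def)
    have "e i \<in> {1..m}" if "i < card U" for i using eU[OF that] U(1) AZ(2) by blast
    moreover have "1 \<in> {1..m}" using Q by (simp add: m_def)
    ultimately have g: "g \<in> Gs" unfolding Gs_def g_def by (simp add: PiE_iff)
    have "1 \<notin> Z" using Q by (auto simp: Z_def)
    have TU: "T g = U"
    proof
      show "T g \<subseteq> U" using eU \<open>1 \<notin> Z\<close> by (auto simp: T_def g_def split: if_splits)
      show "U \<subseteq> T g"
      proof
        fix u assume u: "u \<in> U"
        then have "u \<in> e ` {0..<card U}" using e unfolding bij_betw_def by blast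
        then obtain i where "u = e i" "i \<in> {0..<card U}" by (rule imageE)
        then have "g i = u" "i \<in> {..<q}" using cU by (simp_all add: g_def)
        then show "u \<in> T g" using u U(1) unfolding T_def by blast
      qed
    qed
    define \<psi> where "\<psi> = restrict (inv' x) (A - f ` A)"
    have xi: "x (inv' x a) = a" for a using permutes_inverses(1)[OF p] .
    have "inv' x a \<in> W f (T g)" if a: "a \<in> A - f ` A" for a
    proof -
      have pre: "inv' x a \<in> preim x" using a xi by (simp add: preim_def)
      moreover have "inv' x a \<notin> A" using a xi[of a] unfolding fA by (metis DiffE imageI)
      moreover have "inv' x a \<in> {1..m}" using preim_sub[OF x(1)] pre by blast
      ultimately have "inv' x a \<in> preim x \<inter> Z" using AZ(2) by blast
      then show ?thesis using U(3) unfolding W_def TU fA by blast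
    qed
    then have psi: "\<psi> \<in> Ps f g" by (auto simp: Ps_def \<psi>_def)
    have "x \<in> F f \<psi>" using x xi by (simp add: F_def f_def \<psi>_def)
    with f g psi show "x \<in> (\<Union>f\<in>Fs. \<Union>g\<in>Gs. \<Union>\<psi>\<in>Ps f g. F f \<psi>)" by blast
  qed
  moreover have "finite (\<Union>f\<in>Fs. \<Union>g\<in>Gs. \<Union>\<psi>\<in>Ps f g. F f \<psi>)"
    by (rule finite_subset[OF _ finite_alt]) (auto simp: F_def)
  ultimately have "card ?X \<le> card (\<Union>f\<in>Fs. \<Union>g\<in>Gs. \<Union>\<psi>\<in>Ps f g. F f \<psi>)"
    by (intro card_mono)
  also have "\<dots> \<le> m ^ Q * (m ^ q * ((4 * Q\<^sup>2) ^ Q * fact (m - t)))"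
    by (rule card_UN_le_mult[OF cFs(2) cFs(1) cG])
  finally have "card ?X * m ^ r \<le> m ^ Q * (m ^ q * ((4 * Q\<^sup>2) ^ Q * fact (m - t))) * m ^ r"
    by (rule mult_le_mono1)
  also have "\<dots> = m ^ (Q + q + r) * ((4 * Q\<^sup>2) ^ Q * fact (m - t))"
    by (simp add: power_add ac_simps)
  also have "\<dots> \<le> m ^ t * ((4 * Q\<^sup>2) ^ Q * fact (m - t))"
  proof (intro mult_le_mono1 power_increasing)
    \<comment> \<open>This is where domination by at most half of the points pays: with
      \<open>q \<le> Q / 2\<close> and \<open>4 * r \<le> Q\<close>, the \<open>m ^ (Q + q)\<close>
      choices of \<open>f\<close> and \<open>g\<close> fall short of \<open>m ^ t\<close> by at
      least a factor \<open>m ^ r\<close>.\<close>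
    show "Q + q + r \<le> t" using r(2) unfolding t_def q_def by linarith
    show "1 \<le> m" using Q by (simp add: m_def)
  qed
  also have "\<dots> = (4 * Q\<^sup>2) ^ Q * (fact (m - t) * m ^ t)" by (simp add: ac_simps)
  also have "\<dots> \<le> (4 * Q\<^sup>2) ^ Q * (2 ^ t * fact m)"
    using m by (intro mult_left_mono fact_mult_power_le) (auto simp: t_def)
  also have "\<dots> \<le> (4 * Q\<^sup>2) ^ Q * (2 ^ (2 * Q) * fact m)"
    by (intro mult_left_mono mult_right_mono power_increasing) (auto simp: t_def)
  finally show ?thesis unfolding fact_m by (simp add: algebra_simps)
qed

text \<open>Either \<open>x\<close> or \<open>x'\<close> has overlap at least \<open>r\<close> with
  \<open>A\<close>, which \<open>card_overlap\<close> bounds for each of the two, or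
  \<open>x'\<close> has small overlap and \<open>card_not_separated\<close> bounds the choices of
  \<open>x\<close>. The two summands of \<open>badness\<close> are these contributions.\<close>

lemma card_bad_pairs:
  assumes r: "2 * (r - 1)\<^sup>2 < Q" "4 * r \<le> Q" and m: "4 * Q \<le> m"
  shows "card {(x, x') \<in> carrier (alt_group m) \<times> carrier (alt_group m). \<not> separated x x'} * m ^ r
    \<le> badness Q r * (card (carrier (alt_group m)))\<^sup>2"
proof -
  let ?S = "carrier (alt_group m)" and ?c = "card (carrier (alt_group m))"
  define X where "X = {x \<in> ?S. r \<le> card (x ` A \<inter> A)}"
  define Y where "Y x' = {x \<in> ?S. card (x ` A \<inter> A) < r \<and> \<not> separated x x'}" for x'
  let ?U = "X \<times> ?S \<union> ?S \<times> X \<union> (\<Union>x'\<in>?S - X. Y x' \<times> {x'})"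
  have fin: "finite ?S" by (rule finite_alt)
  have "{(x, x') \<in> ?S \<times> ?S. \<not> separated x x'} \<subseteq> ?U" by (auto simp: X_def Y_def)
  moreover have "finite ?U"
    by (rule finite_subset[of _ "?S \<times> ?S"]) (use fin in \<open>auto simp: X_def Y_def\<close>)
  ultimately have "card {(x, x') \<in> ?S \<times> ?S. \<not> separated x x'} \<le> card ?U" by (intro card_mono)
  also have "\<dots> \<le> card (X \<times> ?S) + card (?S \<times> X) + card (\<Union>x'\<in>?S - X. Y x' \<times> {x'})"
    by (meson add_mono card_Un_le le_refl le_trans)
  also have "card (\<Union>x'\<in>?S - X. Y x' \<times> {x'}) \<le> (\<Sum>x'\<in>?S - X. card (Y x' \<times> {x'}))"
    by (rule card_UN_le) (use fin in auto)
  finally have "card {(x, x') \<in> ?S \<times> ?S. \<not> separated x x'} \<le> 2 * (card X * ?c) + (\<Sum>x'\<in>?S - X. card (Y x'))"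
    by (simp add: card_cartesian_product mult.commute)
  then have "card {(x, x') \<in> ?S \<times> ?S. \<not> separated x x'} * m ^ r
      \<le> (2 * (card X * ?c) + (\<Sum>x'\<in>?S - X. card (Y x'))) * m ^ r"
    by (rule mult_le_mono1)
  also have "\<dots> = 2 * (card X * m ^ r) * ?c + (\<Sum>x'\<in>?S - X. card (Y x') * m ^ r)"
    by (simp add: algebra_simps sum_distrib_left)
  also have "\<dots> \<le> 2 * (2 ^ (Q + r + 1) * Q ^ r * ?c) * ?c
      + (\<Sum>x'\<in>?S - X. (4 * Q\<^sup>2) ^ Q * 2 ^ (2 * Q + 1) * ?c)"
  proof (rule add_mono)
    have "card X * m ^ r \<le> 2 ^ (Q + r + 1) * Q ^ r * ?c"
      unfolding X_def by (rule card_overlap) (use r m in linarith)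
    then show "2 * (card X * m ^ r) * ?c \<le> 2 * (2 ^ (Q + r + 1) * Q ^ r * ?c) * ?c"
      by (intro mult_le_mono1 mult_le_mono2)
    have "card (Y x') * m ^ r \<le> (4 * Q\<^sup>2) ^ Q * 2 ^ (2 * Q + 1) * ?c" if "x' \<in> ?S - X" for x'
      unfolding Y_def by (rule card_not_separated) (use that r m in \<open>auto simp: X_def\<close>)
    then show "(\<Sum>x'\<in>?S - X. card (Y x') * m ^ r)
        \<le> (\<Sum>x'\<in>?S - X. (4 * Q\<^sup>2) ^ Q * 2 ^ (2 * Q + 1) * ?c)"
      by (rule sum_mono)
  qed
  also have "(\<Sum>x'\<in>?S - X. (4 * Q\<^sup>2) ^ Q * 2 ^ (2 * Q + 1) * ?c) \<le> ?c * ((4 * Q\<^sup>2) ^ Q * 2 ^ (2 * Q + 1) * ?c)"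
    using card_mono[OF fin, of "?S - X"] by (simp only: sum_constant of_nat_id) (intro mult_le_mono1, auto)
  finally show ?thesis by (simp add: badness_def algebra_simps power2_eq_square)
qed

end

section \<open>Powers of an alternating group\<close>

text \<open>The condition constrains two coordinates and leaves the others free. It says, without
  division, that the proportion of such families is at most that of \<open>P\<close> among
  pairs.\<close>

lemma card_PiE_pair:
  assumes I: "finite I" "i \<in> I" "j \<in> I" "i \<noteq> j" and S: "finite S" and P: "P \<subseteq> S \<times> S"
  shows "card {x \<in> I \<rightarrow>\<^sub>E S. (x i, x j) \<in> P} * (card S)\<^sup>2 \<le> card P * card S ^ card I"
proof -
  let ?J = "I - {i, j}"
  have finP: "finite P" using P S finite_subset by blast
  have "card {x \<in> I \<rightarrow>\<^sub>E S. (x i, x j) \<in> P} \<le> card (P \<times> (?J \<rightarrow>\<^sub>E S))"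
  proof (rule card_inj_on_le)
    show "inj_on (\<lambda>x. ((x i, x j), restrict x ?J)) {x \<in> I \<rightarrow>\<^sub>E S. (x i, x j) \<in> P}"
    proof (rule inj_onI)
      fix x y assume x: "x \<in> {x \<in> I \<rightarrow>\<^sub>E S. (x i, x j) \<in> P}" and y: "y \<in> {x \<in> I \<rightarrow>\<^sub>E S. (x i, x j) \<in> P}"
        and eq: "((x i, x j), restrict x ?J) = ((y i, y j), restrict y ?J)"
      have "x l = y l" if "l \<in> I" for l
      proof (cases "l \<in> ?J")
        case True
        have "restrict x ?J l = restrict y ?J l" using eq by simp
        then show ?thesis using True by simp
      qed (use eq that in auto)
      then show "x = y" using x y by (intro PiE_ext[of x I "\<lambda>_. S" y]) auto
    qed
    show "(\<lambda>x. ((x i, x j), restrict x ?J)) ` {x \<in> I \<rightarrow>\<^sub>E S. (x i, x j) \<in> P} \<subseteq> P \<times> (?J \<rightarrow>\<^sub>E S)"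
    proof
      fix u assume "u \<in> (\<lambda>x. ((x i, x j), restrict x ?J)) ` {x \<in> I \<rightarrow>\<^sub>E S. (x i, x j) \<in> P}"
      then obtain x where x: "u = ((x i, x j), restrict x ?J)" "x \<in> I \<rightarrow>\<^sub>E S" "(x i, x j) \<in> P" by blast
      have "restrict x ?J \<in> ?J \<rightarrow>\<^sub>E S" using x(2) by (simp only: restrict_PiE_iff) auto
      then show "u \<in> P \<times> (?J \<rightarrow>\<^sub>E S)" using x by simp
    qed
    show "finite (P \<times> (?J \<rightarrow>\<^sub>E S))" using finP I S by (auto intro!: finite_PiE)
  qed
  also have "\<dots> = card P * card S ^ card ?J"
    using I by (simp add: card_cartesian_product card_PiE)
  finally have "card {x \<in> I \<rightarrow>\<^sub>E S. (x i, x j) \<in> P} * (card S)\<^sup>2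
      \<le> card P * (card S ^ card ?J * (card S)\<^sup>2)"
    by (simp add: mult_le_mono1 flip: mult.assoc)
  also have "card S ^ card ?J * (card S)\<^sup>2 = card S ^ card I"
  proof -
    have "card I = card ?J + 2"
      using I card_Diff_subset[of "{i, j}" I] card_mono[of I "{i, j}"] by simp
    then show ?thesis by (simp add: power_add power2_eq_square)
  qed
  finally show ?thesis .
qed

text \<open>By hypothesis the ratio of \<open>X - y\<close> to \<open>X\<close> is at most
  \<open>1 - 1/k\<close>, hence at most \<open>exp (- 1/k)\<close>, whose \<open>k\<close>-th power
  is \<open>exp (- 1) \<le> 1/2\<close>.\<close>

lemma two_mult_power_diff_le:
  fixes X y k :: nat
  assumes "X \<le> k * y" "y \<le> X" "k \<ge> 1"
  shows "2 * (X - y) ^ k \<le> X ^ k"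
proof -
  have "real (X - y) \<le> real X * exp (- 1 / real k)"
  proof -
    have "real X / real k \<le> real y"
      using assms by (simp add: divide_simps mult.commute flip: of_nat_mult)
    then have "real (X - y) \<le> real X * (1 + - 1 / real k)"
      using assms by (simp add: algebra_simps of_nat_diff)
    also have "\<dots> \<le> real X * exp (- 1 / real k)"
      by (intro mult_left_mono exp_ge_add_one_self) auto
    finally show ?thesis .
  qed
  then have "real (X - y) ^ k \<le> (real X * exp (- 1 / real k)) ^ k"
    by (intro power_mono) auto
  also have "\<dots> = real X ^ k * exp (- 1)"
    using assms by (simp add: power_mult_distrib flip: exp_of_nat_mult)
  also have "\<dots> \<le> real X ^ k * (1 / 2)"
  proof (rule mult_left_mono)
    show "exp (- 1) \<le> (1 / 2 :: real)"
      using exp_ge_add_one_self[of "1::real"] by (simp add: exp_minus divide_simps)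
  qed auto
  finally have "2 * real (X - y) ^ k \<le> real X ^ k" by simp
  then have "real (2 * (X - y) ^ k) \<le> real (X ^ k)"
    by (simp only: of_nat_mult of_nat_power of_nat_numeral)
  then show ?thesis by (simp only: of_nat_le_iff)
qed

context rotations
begin

lemma hw_commute: "w u \<circ> h s = h s \<circ> w u"
proof
  fix z
  show "(w u \<circ> h s) z = (h s \<circ> w u) z"
  proof (cases "z \<in> A")
    case True
    then have "h s z \<in> A" using hw_A[of z s 0] by simp
    then show ?thesis using True rot_fixes[of _ "Suc Q" M u] by (auto simp: A_def)
  next
    case False
    then have z: "h s z = z" by (intro rot_fixes) (simp add: A_def)
    show ?thesis
    proof (cases "z \<in> Z")
      case True
      then show ?thesis using hw_Z[of z s u] z by simp
    next
      case False
      then have "w u z = z" by (intro rot_fixes) (simp add: Z_def)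
      then show ?thesis using z by simp
    qed
  qed
qed

text \<open>Suitable powers of the constant element give all \<open>h s\<close> and
  \<open>w u\<close>, so the words \<open>x \<circ> h s \<circ> w u \<circ> x\<close> lie in the
  generated subgroup and serve as the elements \<open>y\<close> of
  \<open>power_generates\<close>.\<close>

lemma generate_if_separated:
  assumes I: "finite I" "card I \<ge> 2" and x: "x \<in> I \<rightarrow>\<^sub>E carrier (alt_group m)"
    and sep: "\<And>i j. i \<in> I \<Longrightarrow> j \<in> I \<Longrightarrow> i \<noteq> j \<Longrightarrow> separated (x i) (x j)"
  shows "generate (product_group I (\<lambda>_. alt_group m)) {x, \<lambda>i\<in>I. h 1 \<circ> w 1}
    = carrier (product_group I (\<lambda>_. alt_group m))"
proof -
  let ?G = "product_group I (\<lambda>_. alt_group m)"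
  interpret G: group ?G by (simp add: alt_group_is_group)
  interpret S: group "alt_group m" by (rule alt_group_is_group)
  define K where "K = generate ?G {x, \<lambda>i\<in>I. h 1 \<circ> w 1}"
  have hwc: "h s \<circ> w u \<in> carrier (alt_group m)" for s u
    using S.m_closed[OF h_alt[of s] w_alt[of u]] by (simp add: alt_group_mult)
  have "{x, \<lambda>i\<in>I. h 1 \<circ> w 1} \<subseteq> carrier ?G" using x hwc by auto
  then have K: "subgroup K ?G" unfolding K_def by (rule G.generate_is_subgroup)
  interpret K: subgroup K ?G by (rule K)
  have xK: "x \<in> K" unfolding K_def by (rule generate.incl) simp
  have gK: "(\<lambda>i\<in>I. h 1 \<circ> w 1) \<in> K" unfolding K_def by (rule generate.incl) simp
  have Kmult: "(\<lambda>i\<in>I. f i \<circ> g i) \<in> K" if "f \<in> K" "g \<in> K" for f g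
    using K.m_closed[OF that] by (simp add: alt_group_mult)
  have Kmult': "(\<lambda>i\<in>I. p \<circ> q) \<in> K" if "(\<lambda>i\<in>I. p) \<in> K" "(\<lambda>i\<in>I. q) \<in> K" for p q
    using Kmult[OF that] by (simp cong: restrict_cong)
  have pow: "(\<lambda>i\<in>I. h n \<circ> w n) \<in> K" for n
  proof (induction n)
    case 0
    have "h 0 \<circ> w 0 = id" by simp
    then show ?case using K.one_closed by (simp only: one_product_group alt_group_one)
  next
    case (Suc n)
    have "(h 1 \<circ> w 1) \<circ> (h n \<circ> w n) = h 1 \<circ> (w 1 \<circ> h n) \<circ> w n" by (simp only: comp_assoc)
    also have "\<dots> = (h 1 \<circ> h n) \<circ> (w 1 \<circ> w n)" by (simp only: hw_commute comp_assoc)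
    also have "\<dots> = h (Suc n) \<circ> w (Suc n)" by (simp only: rot_add plus_1_eq_Suc)
    finally have eq: "h 1 \<circ> w 1 \<circ> (h n \<circ> w n) = h (Suc n) \<circ> w (Suc n)" .
    show ?case using Kmult'[OF gK Suc] unfolding eq .
  qed
  have hK: "(\<lambda>i\<in>I. h s) \<in> K" for s
  proof -
    \<comment> \<open>The exponent \<open>M * s\<close> is trivial for \<open>w\<close> and
      congruent to \<open>s\<close> modulo \<open>Q\<close>, which isolates
      \<open>h s\<close>.\<close>
    have "h (M * s) = h (M * s mod Q)" by (rule rot_mod)
    also have "M * s mod Q = s mod Q" using M(3) by (metis mod_mult_left_eq mult_1)
    also have "h (s mod Q) = h s" by (rule rot_mod[symmetric])
    finally have "h (M * s) = h s" .
    moreover have "w (M * s) = id" using rot_mod[of "Suc Q" M "M * s"] by simp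
    ultimately have eq: "h (M * s) \<circ> w (M * s) = h s" by (simp only: comp_id)
    show ?thesis using pow[of "M * s"] unfolding eq .
  qed
  have wK: "(\<lambda>i\<in>I. w u) \<in> K" for u
  proof -
    \<comment> \<open>The shift by \<open>(Q - 1) * u\<close> is the inverse of \<open>h u\<close>,
      so it removes \<open>h u\<close> from the power.\<close>
    have "h ((Q - 1) * u) \<circ> (h u \<circ> w u) = h ((Q - 1) * u + u) \<circ> w u"
      by (simp only: comp_assoc[symmetric] rot_add)
    also have "(Q - 1) * u + u = Q * u" using Q by (cases Q) auto
    also have "h (Q * u) = id" using rot_mod[of 1 Q "Q * u"] by simp
    finally have eq: "h ((Q - 1) * u) \<circ> (h u \<circ> w u) = w u" by (simp only: id_comp)
    show ?thesis using Kmult'[OF hK[of "(Q - 1) * u"] pow[of u]] unfolding eq .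
  qed
  have "K = carrier ?G"
  proof (rule power_generates[OF I K hK wK])
    fix i j assume ij: "i \<in> I" "j \<in> I" "i \<noteq> j"
    obtain s u where su: "card ((h s \<circ> w u) ` x i ` A \<inter> preim (x i)) = 1"
      "(h s \<circ> w u) ` x j ` A \<inter> preim (x j) = {}"
      using sep[OF ij] by (auto simp: separated_def)
    define p where "p = h s \<circ> w u"
    define y where "y = (\<lambda>i\<in>I. x i \<circ> p \<circ> x i)"
    have pK: "(\<lambda>i\<in>I. p) \<in> K" unfolding p_def by (rule Kmult'[OF hK wK])
    have "y \<in> K" using Kmult[OF Kmult[OF xK pK] xK] by (simp add: y_def cong: restrict_cong)
    \<comment> \<open>Pulling back along \<open>x l\<close> turns the condition on \<open>y\<close>
      into the one in \<open>separated\<close>; injectivity of \<open>x i\<close> preserves the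
      cardinality.\<close>
    moreover have im: "y l ` A \<inter> A = x l ` (p ` x l ` A \<inter> preim (x l))" if "l \<in> I" for l
      using that by (auto simp: y_def preim_def)
    moreover have "inj (x i)" using x ij(1) alt_bij by (auto intro: bij_is_inj)
    then have "card (x i ` (p ` x i ` A \<inter> preim (x i))) = card (p ` x i ` A \<inter> preim (x i))"
      by (intro card_image) (rule inj_on_subset, auto)
    ultimately show "\<exists>y\<in>K. card (y i ` A \<inter> A) = 1 \<and> y j ` A \<inter> A = {}"
      using su ij unfolding p_def by (intro bexI[of _ y]) auto
  qed
  then show ?thesis by (simp only: K_def)
qed

text \<open>A union bound over at most \<open>m ^ (2 * D)\<close> ordered pairs of coordinates, each
  failing with probability at most \<open>badness Q (2 * D + 1) / m ^ (2 * D + 1)\<close>.\<close>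

lemma card_not_generating:
  assumes I: "finite I" "card I = m ^ D" "card I \<ge> 2"
    and r: "2 * (2 * D)\<^sup>2 < Q" "4 * (2 * D + 1) \<le> Q"
    and m: "4 * Q \<le> m" "2 * badness Q (2 * D + 1) \<le> m"
  defines "G \<equiv> product_group I (\<lambda>_. alt_group m)"
  shows "2 * card {x \<in> carrier G. generate G {x, \<lambda>i\<in>I. h 1 \<circ> w 1} \<noteq> carrier G} \<le> card (carrier G)"
proof -
  let ?S = "carrier (alt_group m)" and ?r = "2 * D + 1"
  define c where "c = card (carrier (alt_group m))"
  define P where "P = {(x, x') \<in> ?S \<times> ?S. \<not> separated x x'}"
  define Bad where "Bad = {x \<in> carrier G. generate G {x, \<lambda>i\<in>I. h 1 \<circ> w 1} \<noteq> carrier G}"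
  define F where "F = (\<lambda>(i, j). {x \<in> I \<rightarrow>\<^sub>E ?S. (x i, x j) \<in> P})"
  let ?II = "{(i, j) \<in> I \<times> I. i \<noteq> j}"
  have cG: "card (carrier G) = c ^ card I" using I by (simp add: G_def card_PiE c_def)
  have cpos: "c > 0" unfolding c_def using finite_alt h_alt card_gt_0_iff by blast
  have mpos: "m > 0" using Q by (simp add: m_def)
  have finII: "finite ?II" by (rule finite_subset[of _ "I \<times> I"]) (use I in auto)
  have cII: "card ?II \<le> (m ^ D)\<^sup>2"
    using card_mono[of "I \<times> I" ?II] I by (auto simp: card_cartesian_product power2_eq_square)
  have "Bad \<subseteq> (\<Union>p\<in>?II. F p)"
  proof
    fix x assume x: "x \<in> Bad"
    then have xS: "x \<in> I \<rightarrow>\<^sub>E ?S" by (simp add: Bad_def G_def)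
    then obtain i j where ij: "i \<in> I" "j \<in> I" "i \<noteq> j" "\<not> separated (x i) (x j)"
      using generate_if_separated[OF I(1,3) xS] x unfolding Bad_def G_def by blast
    then have "x \<in> F (i, j)" using xS by (auto simp: F_def P_def)
    with ij show "x \<in> (\<Union>p\<in>?II. F p)" by blast
  qed
  moreover have "finite (\<Union>p\<in>?II. F p)"
    by (rule finite_subset[of _ "I \<rightarrow>\<^sub>E ?S"]) (use I finite_alt in \<open>auto simp: F_def intro!: finite_PiE\<close>)
  ultimately have "card Bad \<le> card (\<Union>p\<in>?II. F p)" by (intro card_mono)
  also have "\<dots> \<le> (\<Sum>p\<in>?II. card (F p))" by (rule card_UN_le[OF finII])
  finally have "card Bad * c\<^sup>2 \<le> (\<Sum>p\<in>?II. card (F p)) * c\<^sup>2" by (rule mult_le_mono1)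
  also have "\<dots> = (\<Sum>p\<in>?II. card (F p) * c\<^sup>2)" by (rule sum_distrib_right)
  also have "\<dots> \<le> (\<Sum>p\<in>?II. card P * c ^ card I)"
  proof (rule sum_mono)
    fix p assume "p \<in> ?II"
    then obtain i j where "p = (i, j)" "i \<in> I" "j \<in> I" "i \<noteq> j" by auto
    then show "card (F p) * c\<^sup>2 \<le> card P * c ^ card I"
      using card_PiE_pair[OF I(1) _ _ _ finite_alt, of i j P] by (auto simp: F_def P_def c_def)
  qed
  also have "\<dots> = card ?II * (card P * c ^ card I)" by simp
  also have "\<dots> \<le> (m ^ D)\<^sup>2 * (card P * c ^ card I)" by (rule mult_le_mono1[OF cII])
  finally have "card Bad * c\<^sup>2 * m ^ ?r \<le> (m ^ D)\<^sup>2 * (card P * c ^ card I) * m ^ ?r"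
    by (rule mult_le_mono1)
  also have "\<dots> = (m ^ D)\<^sup>2 * c ^ card I * (card P * m ^ ?r)" by (simp only: ac_simps)
  also have "\<dots> \<le> (m ^ D)\<^sup>2 * c ^ card I * (badness Q ?r * c\<^sup>2)"
    unfolding P_def c_def by (intro mult_le_mono2 card_bad_pairs) (use r m in auto)
  \<comment> \<open>After cancellation a single factor \<open>m\<close> remains, and it is at least
    twice the constant.\<close>
  finally have "(m ^ D)\<^sup>2 * c\<^sup>2 * (card Bad * m) \<le> (m ^ D)\<^sup>2 * c\<^sup>2 * (badness Q ?r * c ^ card I)"
    by (simp add: power_add power_mult power2_eq_square ac_simps)
  then have "card Bad * m \<le> badness Q ?r * c ^ card I"
    using mpos cpos by simp
  moreover have "badness Q ?r * (2 * card Bad) = card Bad * (2 * badness Q ?r)" by (simp only: ac_simps)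
  moreover have "card Bad * (2 * badness Q ?r) \<le> card Bad * m" by (rule mult_le_mono2[OF m(2)])
  ultimately have "badness Q ?r * (2 * card Bad) \<le> badness Q ?r * c ^ card I" by linarith
  moreover have "badness Q ?r > 0" using Q by (simp add: badness_def)
  ultimately have "2 * card Bad \<le> c ^ card I" using nat_mult_le_cancel1 by blast
  then show ?thesis unfolding cG Bad_def .
qed

text \<open>The values of \<open>s 1\<close> split the group into at most \<open>m\<close> fibres;
  each nonempty fibre is a coset of the stabilizer.\<close>

lemma card_alt_le_stabilizer:
  "card (carrier (alt_group m)) \<le> m * card {s \<in> carrier (alt_group m). s 1 = 1}"
proof -
  let ?S = "carrier (alt_group m)"
  interpret S: group "alt_group m" by (rule alt_group_is_group)
  have 1: "1 \<in> {1..m}" using Q by (simp add: m_def)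
  have le: "card {s \<in> ?S. s 1 = p} \<le> card {s \<in> ?S. s 1 = 1}" for p
  proof (cases "{s \<in> ?S. s 1 = p} = {}")
    case False
    then obtain s0 where s0: "s0 \<in> ?S" "s0 1 = p" by blast
    note b = alt_bij[OF s0(1)]
    show ?thesis
    proof (rule card_inj_on_le)
      show "inj_on (\<lambda>s. inv' s0 \<circ> s) {s \<in> ?S. s 1 = p}"
      proof (rule inj_onI)
        have R: "s0 \<circ> (inv' s0 \<circ> s) = s" for s :: "nat \<Rightarrow> nat"
          by (simp only: comp_assoc[symmetric] permutes_inv_o(1)[OF alt_perm[OF s0(1)]] id_comp)
        fix s t :: "nat \<Rightarrow> nat" assume eq: "inv' s0 \<circ> s = inv' s0 \<circ> t"
        show "s = t" using arg_cong[OF eq, of "\<lambda>f. s0 \<circ> f"] by (simp only: R)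
      qed
      show "(\<lambda>s. inv' s0 \<circ> s) ` {s \<in> ?S. s 1 = p} \<subseteq> {s \<in> ?S. s 1 = 1}"
        using S.m_closed[OF alt_group_inv_closed[OF s0(1)]] s0(2) b
        by (auto simp: alt_group_mult inv_f_eq bij_is_inj)
    qed (use finite_alt in auto)
  qed (simp only: card.empty le0)
  have "?S \<subseteq> (\<Union>p\<in>{1..m}. {s \<in> ?S. s 1 = p})"
  proof
    fix s assume s: "s \<in> ?S"
    then have "s 1 \<in> {1..m}" using 1 permutes_in_image[OF alt_perm[OF s]] by blast
    then show "s \<in> (\<Union>p\<in>{1..m}. {s \<in> ?S. s 1 = p})" using s by blast
  qed
  then have "card ?S \<le> card (\<Union>p\<in>{1..m}. {s \<in> ?S. s 1 = p})"
    by (intro card_mono) (use finite_alt in auto)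
  also have "\<dots> \<le> m * card {s \<in> ?S. s 1 = 1}"
    by (rule card_UN_le_mult) (use le in auto)
  finally show ?thesis .
qed

text \<open>In a generating tuple no coordinate has all \<open>D\<close> entries in the stabilizer
  of 1. Each coordinate excludes a proportion of at least \<open>1 / m ^ D\<close>, and there are
  \<open>m ^ D\<close> coordinates, so \<open>two_mult_power_diff_le\<close> applies.\<close>

lemma card_generating_tuples:
  assumes I: "finite I" "card I = m ^ D"
  defines "G \<equiv> product_group I (\<lambda>_. alt_group m)"
  shows "2 * card {f \<in> {1..D} \<rightarrow>\<^sub>E carrier G. generate G (f ` {1..D}) = carrier G} \<le> card (carrier G) ^ D"
proof -
  let ?S = "carrier (alt_group m)" and ?D = "{1..D}"
  interpret S: group "alt_group m" by (rule alt_group_is_group)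
  interpret G: group G unfolding G_def by (simp add: alt_group_is_group)
  define St where "St = {s \<in> ?S. s 1 = 1}"
  define c where "c = card ?S"
  define N where "N = (?D \<rightarrow>\<^sub>E ?S) - (?D \<rightarrow>\<^sub>E St)"
  define E where "E = {f \<in> ?D \<rightarrow>\<^sub>E carrier G. generate G (f ` ?D) = carrier G}"
  have finSt: "finite St" "card St \<le> c"
    using finite_alt card_mono[of ?S St] by (auto simp: St_def c_def)
  have mpos: "m > 0" using Q by (simp add: m_def)
  have cG: "carrier G = (I \<rightarrow>\<^sub>E ?S)" "card (carrier G) = c ^ card I"
    using I by (simp_all add: G_def card_PiE c_def)
  have finN: "finite N" unfolding N_def using finite_alt by (auto intro!: finite_PiE)
  have cN: "card N = c ^ D - card St ^ D"
    unfolding N_def using finSt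
    by (subst card_Diff_subset) (auto simp: card_PiE c_def St_def intro!: finite_PiE PiE_mono)
  have moved: "\<exists>t\<in>?D. f t i \<notin> St" if f: "f \<in> E" and i: "i \<in> I" for f i
  proof (rule ccontr)
    assume "\<not> (\<exists>t\<in>?D. f t i \<notin> St)"
    then have fix1: "\<forall>t\<in>?D. f t i 1 = 1" by (auto simp: St_def)
    define H where "H = {x \<in> carrier G. x i 1 = 1}"
    have "subgroup H G"
    proof (rule G.subgroupI)
      show "H \<subseteq> carrier G" by (auto simp: H_def)
      have "\<one>\<^bsub>G\<^esub> \<in> H" using G.one_closed i by (simp add: H_def G_def alt_group_one)
      then show "H \<noteq> {}" by blast
      show "inv\<^bsub>G\<^esub> a \<in> H" if a: "a \<in> H" for a
      proof -
        have ai: "a i \<in> ?S" using a i cG by (auto simp: H_def)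
        have "(inv\<^bsub>G\<^esub> a) i = inv' (a i)"
          using a i cG unfolding H_def G_def
          by (subst inv_product_group) (auto simp: alt_group_is_group alt_group_inv_equality[OF ai])
        moreover have "inv' (a i) 1 = 1"
          using a alt_bij[OF ai] by (auto simp: H_def intro!: inv_f_eq bij_is_inj)
        ultimately show ?thesis using a by (simp add: H_def)
      qed
      show "a \<otimes>\<^bsub>G\<^esub> b \<in> H" if "a \<in> H" "b \<in> H" for a b
      proof -
        have "(a \<otimes>\<^bsub>G\<^esub> b) i 1 = a i (b i 1)" using i by (simp add: G_def alt_group_mult)
        then show ?thesis using that by (simp add: H_def)
      qed
    qed
    moreover have "f ` ?D \<subseteq> H" using f fix1 by (auto simp: H_def E_def)
    ultimately have "generate G (f ` ?D) \<subseteq> H" by (rule G.generate_subgroup_incl[rotated])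
    then have "carrier G \<subseteq> H" using f by (simp add: E_def)
    \<comment> \<open>The subgroup \<open>H\<close> is proper because \<open>h 1\<close> moves the
      point 1.\<close>
    moreover have "(\<lambda>i\<in>I. h 1) \<in> carrier G" using cG h_alt by auto
    ultimately have "h 1 1 = 1" using i by (auto simp: H_def)
    then show False using h_moves[of 1] Q by (auto simp: A_def)
  qed
  have "card E \<le> card (I \<rightarrow>\<^sub>E N)"
  proof (rule card_inj_on_le)
    \<comment> \<open>Exchanging the two indices turns a tuple in the power into a family of tuples
      in the alternating group, one per coordinate; by \<open>moved\<close> each lies in
      \<open>N\<close>.\<close>
    let ?\<phi> = "\<lambda>f. \<lambda>i\<in>I. \<lambda>t\<in>?D. f t i"
    show "inj_on ?\<phi> E"
    proof (rule inj_onI)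
      fix f g assume f: "f \<in> E" and g: "g \<in> E" and eq: "?\<phi> f = ?\<phi> g"
      have fg: "f t \<in> I \<rightarrow>\<^sub>E ?S" "g t \<in> I \<rightarrow>\<^sub>E ?S" if "t \<in> ?D" for t
        using f g that cG by (auto simp: E_def)
      have "f t i = g t i" if "t \<in> ?D" "i \<in> I" for t i
        using fun_cong[OF fun_cong[OF eq, of i], of t] that by simp
      then have "f t = g t" if "t \<in> ?D" for t
        using fg[OF that] that by (intro PiE_ext[of "f t" I "\<lambda>_. ?S" "g t"]) auto
      then show "f = g"
        using f g by (intro PiE_ext[of f ?D "\<lambda>_. carrier G" g]) (auto simp: E_def)
    qed
    show "?\<phi> ` E \<subseteq> (I \<rightarrow>\<^sub>E N)"
    proof
      fix F assume "F \<in> ?\<phi> ` E"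
      then obtain f where f: "f \<in> E" "F = ?\<phi> f" by blast
      have "(\<lambda>t\<in>?D. f t i) \<in> N" if i: "i \<in> I" for i
      proof -
        have "f t i \<in> ?S" if "t \<in> ?D" for t using f(1) i that cG by (auto simp: E_def PiE_iff)
        moreover obtain t where "t \<in> ?D" "f t i \<notin> St" using moved[OF f(1) i] by blast
        ultimately show ?thesis by (auto simp: N_def PiE_iff)
      qed
      then show "F \<in> I \<rightarrow>\<^sub>E N" using f(2) by auto
    qed
    show "finite (I \<rightarrow>\<^sub>E N)" using I finN by (intro finite_PiE) auto
  qed
  also have "\<dots> = (c ^ D - card St ^ D) ^ (m ^ D)" using I cN by (simp add: card_PiE)
  finally have "2 * card E \<le> 2 * (c ^ D - card St ^ D) ^ (m ^ D)" by simp
  also have "\<dots> \<le> (c ^ D) ^ (m ^ D)"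
  proof (rule two_mult_power_diff_le)
    have "c \<le> m * card St" using card_alt_le_stabilizer by (simp add: c_def St_def)
    then have "c ^ D \<le> (m * card St) ^ D" by (intro power_mono) auto
    then show "c ^ D \<le> m ^ D * card St ^ D" by (simp add: power_mult_distrib)
    show "card St ^ D \<le> c ^ D" by (intro power_mono finSt) auto
    show "1 \<le> m ^ D" using mpos by (simp add: Suc_le_eq)
  qed
  also have "\<dots> = card (carrier G) ^ D" using I cG(2) by (simp flip: power_mult add: mult.commute)
  finally show ?thesis by (simp only: E_def)
qed

end

section \<open>Choice of the parameters\<close>

theorem theorem3:
  fixes n :: nat
  assumes "n \<ge> 1"
  shows "\<exists>G :: nat monoid. group G \<and> finite (carrier G) \<and> carrier G \<noteq> {\<one>\<^bsub>G\<^esub>} \<and> two_generated G \<and>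
    exp_gen_time G {} \<ge> of_nat n \<and>
    (\<exists>g\<in>carrier G. exp_gen_time G {g} \<le> 5)"
proof -
  \<comment> \<open>The tuple length in \<open>exp_gen_time_ge\<close>, and hence the exponent in
    the number \<open>m ^ D\<close> of coordinates.\<close>
  define D where "D = 2 * n"
  \<comment> \<open>An odd number large enough for both size conditions with
    \<open>r = 2 * D + 1\<close>.\<close>
  define Q where "Q = 2 * (2 * D + 1)\<^sup>2 + 1"
  \<comment> \<open>A multiple of \<open>2 * Q\<close> plus 1, hence odd and congruent to 1 modulo
    \<open>Q\<close>. The constant \<open>badness\<close> depends only on \<open>Q\<close> and
    \<open>D\<close>, so \<open>M\<close> can be taken large relative to it; the summand 2 ensures
    \<open>4 * Q \<le> m\<close>.\<close>
  define M where "M = Q * (2 * (badness Q (2 * D + 1) + 2)) + 1"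
  have D: "D \<ge> 2" using assms by (simp add: D_def)
  have Q1: "odd Q" "Q \<ge> 2" by (auto simp: Q_def)
  have M1: "odd M" "M \<ge> 2" using Q1 by (auto simp: M_def)
  have "M mod Q = 1 mod Q" unfolding M_def by (rule mod_mult_self4)
  then have M2: "M mod Q = 1" using Q1 by simp
  interpret rotations Q M "Q + M" "{1..<1 + Q}" "{Suc Q..<Suc Q + M}"
    by unfold_locales (use Q1 M1 M2 in auto)
  define m where "m = Q + M"
  define k where "k = m ^ D"
  define G where "G = product_group {..<k} (\<lambda>_. alt_group m)"
  define g where "g = (\<lambda>i\<in>{..<k}. h 1 \<circ> w 1)"
  have Qr: "2 * (2 * D)\<^sup>2 < Q" "4 * (2 * D + 1) \<le> Q"
  proof -
    show "2 * (2 * D)\<^sup>2 < Q" by (simp add: Q_def power2_eq_square)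
    have "2 * (2 * D + 1) \<le> (2 * D + 1) * (2 * D + 1)" using D by (intro mult_le_mono1) simp
    then show "4 * (2 * D + 1) \<le> Q" unfolding Q_def power2_eq_square by linarith
  qed
  have m: "4 * Q \<le> m" "2 * badness Q (2 * D + 1) \<le> m"
  proof -
    show "4 * Q \<le> m" by (simp add: m_def M_def algebra_simps)
    have "1 * (2 * badness Q (2 * D + 1)) \<le> Q * (2 * (badness Q (2 * D + 1) + 2))"
      using Q1 by (intro mult_le_mono) auto
    then show "2 * badness Q (2 * D + 1) \<le> m" by (simp add: m_def M_def)
  qed
  have "2 \<le> m" using m(1) Q1 by simp
  also have "m \<le> m ^ D" using \<open>2 \<le> m\<close> D self_le_power[of m D] by simp
  finally have k2: "k \<ge> 2" by (simp add: k_def)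
  have grp: "group G" unfolding G_def by (simp add: alt_group_is_group)
  have fin: "finite (carrier G)"
    using finite_alt by (auto simp: G_def m_def intro!: finite_PiE)
  have gc: "g \<in> carrier G"
    using monoid.m_closed[OF group.is_monoid[OF alt_group_is_group] h_alt[of 1] w_alt[of 1]]
    by (auto simp: g_def G_def alt_group_mult m_def)
  have bad: "2 * card {x \<in> carrier G. generate G {x, g} \<noteq> carrier G} \<le> card (carrier G)"
    using card_not_generating[of "{..<k}" D] Qr m k2
    by (simp add: G_def g_def m_def k_def)
  have few: "2 * card {f \<in> {1..2 * n} \<rightarrow>\<^sub>E carrier G. generate G (f ` {1..2 * n}) = carrier G}
      \<le> card (carrier G) ^ (2 * n)"
    using card_generating_tuples[of "{..<k}" D] by (simp add: G_def m_def k_def D_def)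
  from exists_nat_group_if_counts[OF grp fin gc assms bad few]
  obtain H :: "nat monoid" and y where H: "group H" "finite (carrier H)" "carrier H \<noteq> {\<one>\<^bsub>H\<^esub>}"
    "two_generated H" "exp_gen_time H {} \<ge> of_nat n" "y \<in> carrier H" "exp_gen_time H {y} \<le> 2"
    by blast
  have "exp_gen_time H {y} \<le> 5" using H(7) by (rule order_trans) simp
  with H show ?thesis by blast
qed

end
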